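(* Let $d\ge1$, $q\ge1$ be integers and $D>0$. Let $\Omega_{\mathbf{x}},\Omega_{\mathbf{y}}\subset[0,D/\sqrt d]^d$, and suppose there are $D_{\mathbf{x}}<D$ and $D_{\mathbf{y}}<D$ such that $\|\mathbf{x}-\mathbf{x}'\|_2\le D_{\mathbf{x}}$ for all $\mathbf{x},\mathbf{x}'\in\Omega_{\mathbf{x}}$ and $\|\mathbf{y}-\mathbf{y}'\|_2\le D_{\mathbf{y}}$ for all $\mathbf{y},\mathbf{y}'\in\Omega_{\mathbf{y}}$. Let $\mathcal{K}(\mathbf{x},\mathbf{y})=f(\|\mathbf{x}-\mathbf{y}\|_2^2)$ for a real-valued function $f$, and let $$f_p(x)=\sum_{n\in\mathbb{Z}}\mathcal{T}\circ f(x+4nD^2)$$ be a $4D^2$-periodic extension of $f$, where the window $\mathcal{T}$ is $1$ on $[-D^2,D^2]$ and smoothly decays to $0$ outside of this interval, so that $f_p=f$ on $[-D^2,D^2]$. Assume that $f_p$ and its derivatives through $f_p^{(q-1)}$ are continuous, and that the $q$-th derivative $f_p^{(q)}$ is piecewise continuous with total variation over one period bounded by $V_q$. Then for all positive integers $M_f,M_t$ with $9M_f\le M_t$ there exist an integer $$R\le 4M_f\binom{M_t+d}{d}$$ and real-valued functions $g_1,\dots,g_R$ on $\Omega_{\mathbf{x}}$ and $h_1,\dots,h_R$ on $\Omega_{\mathbf{y}}$ such that for all $\mathbf{x}\in\Omega_{\mathbf{x}}$, $\mathbf{y}\in\Omega_{\mathbf{y}}$, $$\Big|\mathcal{K}(\mathbf{x},\mathbf{y})-\sum_{i=1}^{R}g_i(\mathbf{x})h_i(\mathbf{y})\Big|\le\|f\|_\infty\left(\frac{D_{\mathbf{x}}D_{\mathbf{y}}}{D^2}\right)^{M_t+1}+\frac{V_q}{\pi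 q}\left(\frac{2D^2}{\pi M_f}\right)^q,$$ where $\|f\|_\infty$ denotes the supremum norm of the periodic function $f_p$.
   Context: Here $\mathcal{T}\circ f$ denotes $f$ multiplied by a smooth window (cut-off) function which equals $1$ on $[-D^2,D^2]$, decays smoothly to $0$ outside it, and is supported so that the shifted copies do not affect $[-D^2,D^2]$; $f$ is understood to be defined wherever the window is nonzero. The domain assumption gives $\|\mathbf{x}-\mathbf{y}\|_2^2\le D^2$ for all $\mathbf{x}\in\Omega_{\mathbf{x}}$, $\mathbf{y}\in\Omega_{\mathbf{y}}$. *)

theory Defs
  imports "HOL-Analysis.Analysis"
begin

definition smooth :: "(real \<Rightarrow> real) \<Rightarrow> bool" where
  "smooth g \<longleftrightarrow> (\<forall>k x. (deriv ^^ k) g differentiable (at x))"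

(* The copies of the window shifted by 4 * n * D^2 with n \<noteq> 0 vanish on [-D^2, D^2] as soon as
   the support is contained in [-3 * D^2, 3 * D^2]. No particular shape (values in [0, 1],
   monotone flanks) is imposed on the transition from 1 to 0. *)
definition window :: "real \<Rightarrow> (real \<Rightarrow> real) \<Rightarrow> bool" where
  "window D T \<longleftrightarrow>
     smooth T \<and> (\<forall>x. \<bar>x\<bar> \<le> D\<^sup>2 \<longrightarrow> T x = 1) \<and> (\<forall>x. \<bar>x\<bar> \<ge> 3 * D\<^sup>2 \<longrightarrow> T x = 0)"

(* For a window T only finitely many terms are nonzero for each x, so the value of f outside the
   support of T is irrelevant. *)
definition periodic_extension :: "real \<Rightarrow> (real \<Rightarrow> real) \<Rightarrow> (real \<Rightarrow> real) \<Rightarrow> real \<Rightarrow> real" where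
  "periodic_extension D T f x =
     (\<Sum>\<^sub>\<infinity>n::int. T (x + 4 * of_int n * D\<^sup>2) * f (x + 4 * of_int n * D\<^sup>2))"

definition piecewise_continuous :: "(real \<Rightarrow> real) \<Rightarrow> bool" where
  "piecewise_continuous g \<longleftrightarrow>
     (\<forall>a b. finite {x \<in> {a..b}. \<not> isCont g x}) \<and>
     (\<forall>x. (\<exists>l. (g \<longlongrightarrow> l) (at_left x)) \<and> (\<exists>r. (g \<longlongrightarrow> r) (at_right x)))"

(* g' is the derivative of g wherever that exists, which is everywhere except for finitely many
   points of each bounded interval; at those points the value of g' is unconstrained. *)
definition derivative_except_breaks :: "(real \<Rightarrow> real) \<Rightarrow> (real \<Rightarrow> real) \<Rightarrow> bool" where
  "derivative_except_breaks g g' \<longleftrightarrow>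
     (\<forall>a b. finite {x \<in> {a..b}. \<not> g differentiable (at x)}) \<and>
     (\<forall>x. g differentiable (at x) \<longrightarrow> (g has_real_derivative g' x) (at x))"

definition total_variation :: "(real \<Rightarrow> real) \<Rightarrow> real \<Rightarrow> real \<Rightarrow> ereal" where
  "total_variation g a b =
     (SUP (n, t) \<in> {(n, t). t 0 = a \<and> t n = b \<and> (\<forall>i<n. t i \<le> t (Suc i))}.
        ereal (\<Sum>i<n. \<bar>g (t (Suc i)) - g (t i)\<bar>))"

(* V bounds the total variation, over one period P, of the q-th derivative of the P-periodic
   function g. That derivative is represented by a P-periodic function u defined everywhere. The
   choice of the values of u at the breakpoints is free; its periodicity makes a jump located at
   the endpoints of the period contribute to the variation. *)
definition qth_derivative_variation_le ::
    "nat \<Rightarrow> real \<Rightarrow> (real \<Rightarrow> real) \<Rightarrow> real \<Rightarrow> bool" where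
  "qth_derivative_variation_le q P g V \<longleftrightarrow>
     (\<exists>u. periodic_fun_simple u P \<and>
          derivative_except_breaks ((deriv ^^ (q - 1)) g) u \<and>
          piecewise_continuous u \<and>
          total_variation u (- P / 2) (P / 2) \<le> ereal V)"

end

theory Submission
  imports Defs "HOL-Probability.Characteristic_Functions"
begin

text \<open>
  The periodic extension of \<open>f\<close> is replaced by its Fourier sum of order \<open>Mf\<close>. Its Fourier
  coefficients decay like \<open>V / (2 \<pi> \<bar>k\<bar>) * (P / (2 \<pi> \<bar>k\<bar>)) ^ q\<close> for the period \<open>P = 4 * D\<^sup>2\<close>,
  and summing this over \<open>\<bar>k\<bar> > Mf\<close> gives the second error term.

  Each remaining wave is evaluated at \<open>\<parallel>x - y\<parallel>\<^sup>2 = a x + b y - 2 * (u \<bullet> v)\<close>, where \<open>u\<close> and \<open>v\<close> are the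
  offsets of \<open>x\<close> and \<open>y\<close> from points of \<open>\<Omega>x\<close> and \<open>\<Omega>y\<close>. The factors depending on \<open>a x\<close> and \<open>b y\<close>
  separate; the factor \<open>exp (- 2 \<i> \<omega> * (u \<bullet> v))\<close> is replaced by its Taylor polynomial of degree \<open>Mt\<close>,
  which is a combination of the \<open>(Mt + d) choose d\<close> products of monomials \<open>u^\<alpha> * v^\<alpha>\<close> of degree at
  most \<open>Mt\<close>. Real parts double the rank, and the Taylor errors add up to the first error term
  because \<open>2 * Mf * (\<pi> * Mf) ^ (Mt + 1) / (Mt + 1)! \<le> 1\<close> as soon as \<open>9 * Mf \<le> Mt\<close>.
\<close>

section \<open>Waves and Fourier coefficients\<close>

definition wave :: "real \<Rightarrow> int \<Rightarrow> real \<Rightarrow> complex" where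
  "wave P k t = cis (2 * pi * of_int k / P * t)"

definition fourier_coeff :: "real \<Rightarrow> (real \<Rightarrow> real) \<Rightarrow> int \<Rightarrow> complex" where
  "fourier_coeff P f k =
     integral {- (P / 2)..P / 2} (\<lambda>t. complex_of_real (f t) * wave P (- k) t) / of_real P"

lemma wave_0 [simp]: "wave P 0 t = 1"
  by (simp add: wave_def)

lemma norm_wave [simp]: "norm (wave P k t) = 1"
  by (simp add: wave_def)

lemma wave_mult: "wave P k t * wave P l t = wave P (k + l) t"
  by (simp add: wave_def cis_mult ring_distribs add_divide_distrib)

lemma cnj_wave: "cnj (wave P k t) = wave P (- k) t"
  by (simp add: wave_def cis_cnj)

lemma wave_add: "wave P k (s + t) = wave P k s * wave P k t"
  by (simp add: wave_def cis_mult ring_distribs add_divide_distrib)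

lemma wave_period [simp]: "P \<noteq> 0 \<Longrightarrow> wave P k P = 1"
  by (simp add: wave_def)

lemma continuous_on_wave [continuous_intros]: "continuous_on S (wave P k)"
  unfolding wave_def by (cases "P = 0") (auto intro!: continuous_intros simp: cis_conv_exp)

lemma has_vector_derivative_wave:
  "(wave P k has_vector_derivative \<i> * of_real (2 * pi * of_int k / P) * wave P k t) (at t within S)"
proof -
  have "((\<lambda>t. cis (c * t)) has_vector_derivative \<i> * of_real c * cis (c * t)) (at t within S)" for c
    unfolding has_vector_derivative_def
    by (auto intro!: derivative_eq_intros simp: scaleR_conv_of_real fun_eq_iff)
  then show ?thesis unfolding wave_def[abs_def] .
qed

lemma integral_wave:
  assumes "P > 0"
  shows "integral {- (P / 2)..P / 2} (wave P k) = (if k = 0 then of_real P else 0)"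
proof (cases "k = 0")
  case True
  then have "wave P k = (\<lambda>_. 1)" by (auto simp: fun_eq_iff)
  with True assms show ?thesis by (simp add: scaleR_conv_of_real)
next
  case False
  have "((\<lambda>t. \<i> * of_real (2 * pi * of_int k / P) * wave P k t) has_integral
         wave P k (P / 2) - wave P k (- (P / 2))) {- (P / 2)..P / 2}"
    using assms by (intro fundamental_theorem_of_calculus has_vector_derivative_wave) auto
  moreover have "wave P k (P / 2) = wave P k (- (P / 2))"
    using wave_add[of P k "- (P / 2)" P] assms by simp
  ultimately have "((\<lambda>t. \<i> * of_real (2 * pi * of_int k / P) * wave P k t) has_integral 0)
    {- (P / 2)..P / 2}" by simp
  from has_integral_mult_right[OF this, of "1 / (\<i> * of_real (2 * pi * of_int k / P))"]
  have "(wave P k has_integral 0) {- (P / 2)..P / 2}"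
    using False assms by simp
  with False show ?thesis by (simp add: integral_unique)
qed

section \<open>Translation, differentiation and size of Fourier coefficients\<close>

text \<open>The shifted period \<open>{a + h..a + P + h}\<close> is cut at \<open>a + P\<close>.
  Periodicity carries the piece beyond the cut back to \<open>{a..a + h}\<close>, so that the two
  pieces reassemble to \<open>{a..a + P}\<close>.\<close>

lemma periodic_has_integral_shift:
  fixes f :: "real \<Rightarrow> 'a::euclidean_space"
  assumes "P > 0" "\<And>t. f (t + P) = f t" "f integrable_on {a..a + P}" "0 \<le> h" "h \<le> P"
  shows "((\<lambda>t. f (t + h)) has_integral integral {a..a + P} f) {a..a + P}"
proof -
  have 1: "(f has_integral integral {a..a + h} f) {a..a + h}"
    using assms by (intro integrable_integral integrable_on_subinterval[OF assms(3)]) auto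
  have 2: "(f has_integral integral {a + h..a + P} f) {a + h..a + P}"
    using assms by (intro integrable_integral integrable_on_subinterval[OF assms(3)]) auto
  have "f \<circ> (+) P = f"
    using assms(2) by (auto simp: fun_eq_iff add.commute)
  with 1 have "(f has_integral integral {a..a + h} f) {a + P..a + h + P}"
    using has_integral_shift_Icc_real[of f P _ a "a + h"] by simp
  from has_integral_combine[OF _ _ 2 this]
  have "(f has_integral (integral {a + h..a + P} f + integral {a..a + h} f)) {a + h..a + P + h}"
    using assms by (simp add: add_ac)
  moreover have "integral {a + h..a + P} f + integral {a..a + h} f = integral {a..a + P} f"
    using Henstock_Kurzweil_Integration.integral_combine[OF _ _ assms(3), of "a + h"] assms by (simp add: add.commute)
  ultimately have "(f \<circ> (+) h has_integral integral {a..a + P} f) {a..a + P}"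
    using has_integral_shift_Icc_real[of f h _ a "a + P"] by (simp add: add_ac)
  then show ?thesis by (simp add: o_def add.commute)
qed

text \<open>Shifting the whole integrand also shifts the wave; multiplication by
  \<open>wave P k h\<close> undoes that and leaves this factor on the coefficient.\<close>

lemma fourier_coeff_shift:
  fixes u :: "real \<Rightarrow> real"
  assumes "P > 0" "\<And>t. u (t + P) = u t" "0 \<le> h" "h \<le> P"
    and "(\<lambda>t. complex_of_real (u t) * wave P (- k) t) integrable_on {- (P / 2)..P / 2}"
  shows "((\<lambda>t. complex_of_real (u (t + h)) * wave P (- k) t) has_integral
      of_real P * wave P k h * fourier_coeff P u k) {- (P / 2)..P / 2}"
proof -
  let ?f = "\<lambda>t. complex_of_real (u t) * wave P (- k) t"
  have *: "- (P / 2) + P = P / 2" by simp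
  have "((\<lambda>t. ?f (t + h)) has_integral integral {- (P / 2)..P / 2} ?f) {- (P / 2)..P / 2}"
    using periodic_has_integral_shift[of P ?f "- (P / 2)" h] assms unfolding * by (simp add: wave_add)
  from has_integral_mult_right[OF this, of "wave P k h"]
  have "((\<lambda>t. wave P k h * ?f (t + h)) has_integral
      wave P k h * integral {- (P / 2)..P / 2} ?f) {- (P / 2)..P / 2}" .
  moreover have "wave P k h * ?f (t + h) = complex_of_real (u (t + h)) * wave P (- k) t" for t
    using wave_mult[of P k h "- k"] by (simp add: wave_add algebra_simps)
  ultimately show ?thesis using assms(1) by (simp add: fourier_coeff_def)
qed

text \<open>Integration by parts over one period, where the boundary terms cancel by periodicity.
  Continuity of \<open>f\<close> bridges the finitely many exceptional points in \<open>S\<close>,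
  and integrability of \<open>f'\<close> against the wave comes out of the fundamental theorem for
  the gauge integral instead of being assumed.\<close>

lemma fourier_coeff_derivative:
  fixes f f' :: "real \<Rightarrow> real"
  assumes P: "P > 0" and per: "\<And>t. f (t + P) = f t" and cont: "continuous_on UNIV f"
    and "finite S"
    and der: "\<And>t. t \<in> {- (P / 2)<..<P / 2} - S \<Longrightarrow> (f has_real_derivative f' t) (at t)"
  shows "(\<lambda>t. complex_of_real (f' t) * wave P (- k) t) integrable_on {- (P / 2)..P / 2}"
    and "fourier_coeff P f' k = \<i> * of_real (2 * pi * of_int k / P) * fourier_coeff P f k"
proof -
  let ?w = "\<i> * complex_of_real (2 * pi * of_int k / P)"
  let ?F = "\<lambda>t. complex_of_real (f t) * wave P (- k) t"
  let ?F' = "\<lambda>t. complex_of_real (f' t) * wave P (- k) t"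
  have contF: "continuous_on A ?F" for A
    by (intro continuous_intros continuous_on_subset[OF cont]) auto
  have "((\<lambda>t. ?F' t + complex_of_real (f t) * (- ?w * wave P (- k) t)) has_integral
      ?F (P / 2) - ?F (- (P / 2))) {- (P / 2)..P / 2}"
  proof (rule fundamental_theorem_of_calculus_interior_strong[OF \<open>finite S\<close>])
    fix t assume "t \<in> {- (P / 2)<..<P / 2} - S"
    from der[OF this]
    have "((\<lambda>t. complex_of_real (f t)) has_vector_derivative complex_of_real (f' t)) (at t)"
      by (intro has_vector_derivative_of_real)
         (simp add: has_real_derivative_iff_has_vector_derivative)
    from has_vector_derivative_mult[OF this has_vector_derivative_wave[of P "- k" t UNIV]]
    show "(?F has_vector_derivative ?F' t + complex_of_real (f t) * (- ?w * wave P (- k) t)) (at t)"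
      by (simp add: add.commute)
  qed (use P contF in auto)
  moreover have "?F (P / 2) = ?F (- (P / 2))"
    using wave_add[of P "- k" "- (P / 2)" P] per[of "- (P / 2)"] P by simp
  ultimately have "((\<lambda>t. ?F' t + complex_of_real (f t) * (- ?w * wave P (- k) t)) has_integral 0)
      {- (P / 2)..P / 2}" by simp
  moreover have "((\<lambda>t. ?w * ?F t) has_integral ?w * integral {- (P / 2)..P / 2} ?F) {- (P / 2)..P / 2}"
    by (intro has_integral_mult_right integrable_integral integrable_continuous_real contF)
  ultimately have "((\<lambda>t. ?F' t + complex_of_real (f t) * (- ?w * wave P (- k) t) + ?w * ?F t)
      has_integral 0 + ?w * integral {- (P / 2)..P / 2} ?F) {- (P / 2)..P / 2}"
    by (rule has_integral_add)
  moreover have "?F' t + complex_of_real (f t) * (- ?w * wave P (- k) t) + ?w * ?F t = ?F' t" for t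
    by (simp add: algebra_simps)
  ultimately have "(?F' has_integral ?w * integral {- (P / 2)..P / 2} ?F) {- (P / 2)..P / 2}"
    by simp
  then show "?F' integrable_on {- (P / 2)..P / 2}"
    and "fourier_coeff P f' k = ?w * fourier_coeff P f k"
    by (auto simp: fourier_coeff_def integral_unique)
qed

lemma norm_fourier_coeff_le:
  assumes P: "P > 0" and cont: "continuous_on UNIV f" and B: "\<And>t. \<bar>f t\<bar> \<le> B"
  shows "norm (fourier_coeff P f k) \<le> B"
proof -
  have "norm (integral {- (P / 2)..P / 2} (\<lambda>t. complex_of_real (f t) * wave P (- k) t))
     \<le> B * (P / 2 - - (P / 2))"
    using P B by (intro integral_bound continuous_intros continuous_on_subset[OF cont])
      (auto simp: norm_mult)
  then show ?thesis
    using P by (simp add: fourier_coeff_def norm_divide field_simps)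
qed

section \<open>Reduction to one period\<close>

lemma periodic_of_int:
  fixes f :: "real \<Rightarrow> 'a"
  assumes "\<And>t. f (t + P) = f t"
  shows "f (t + of_int n * P) = f t"
proof -
  interpret periodic_fun_simple f P by standard (rule assms)
  show ?thesis by (rule plus_of_int)
qed

lemma periodic_reduce:
  fixes f :: "real \<Rightarrow> 'a"
  assumes "P > 0" "\<And>t. f (t + P) = f t"
  obtains s where "s \<in> {- (P / 2)..P / 2}" "f s = f t"
proof
  \<comment> \<open>\<open>?n\<close> is \<open>t / P\<close> rounded to a nearest integer, which
    puts the remainder into the centred period.\<close>
  let ?n = "\<lfloor>t / P + 1 / 2\<rfloor>"
  let ?s = "t + of_int (- ?n) * P"
  have "of_int ?n \<le> t / P + 1 / 2" "t / P + 1 / 2 < of_int ?n + 1" by linarith+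
  then have "of_int ?n * P \<le> (t / P + 1 / 2) * P" "(t / P + 1 / 2) * P < (of_int ?n + 1) * P"
    using assms(1) by (auto intro: mult_right_mono mult_strict_right_mono)
  moreover have "(t / P + 1 / 2) * P = t + P / 2" "(of_int ?n + 1) * P = of_int ?n * P + P"
    using assms(1) by (simp_all add: field_simps)
  ultimately have "of_int ?n * P \<le> t + P / 2" "t + P / 2 < of_int ?n * P + P" by simp_all
  then show "?s \<in> {- (P / 2)..P / 2}" by (simp only: of_int_minus atLeastAtMost_iff) linarith
  show "f ?s = f t" by (rule periodic_of_int[of f P, OF assms(2)])
qed

text \<open>This makes the real \<open>SUP\<close> in the final error term a genuine upper
  bound.\<close>

lemma continuous_periodic_bounded:
  fixes f :: "real \<Rightarrow> real"
  assumes "P > 0" "\<And>t. f (t + P) = f t" "continuous_on UNIV f"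
  shows "bdd_above (range (\<lambda>t. \<bar>f t\<bar>))"
proof -
  have "compact ((\<lambda>t. \<bar>f t\<bar>) ` {- (P / 2)..P / 2})"
    by (intro compact_continuous_image continuous_intros continuous_on_subset[OF assms(3)]) auto
  then have "bdd_above ((\<lambda>t. \<bar>f t\<bar>) ` {- (P / 2)..P / 2})"
    by (intro bounded_imp_bdd_above compact_imp_bounded)
  moreover have "range (\<lambda>t. \<bar>f t\<bar>) \<subseteq> (\<lambda>t. \<bar>f t\<bar>) ` {- (P / 2)..P / 2}"
  proof
    fix y assume "y \<in> range (\<lambda>t. \<bar>f t\<bar>)"
    then obtain t where "y = \<bar>f t\<bar>" by blast
    moreover obtain s where "s \<in> {- (P / 2)..P / 2}" "f s = f t"
      using periodic_reduce[of P f, OF assms(1,2)] by blast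
    ultimately show "y \<in> (\<lambda>t. \<bar>f t\<bar>) ` {- (P / 2)..P / 2}" by (metis image_eqI)
  qed
  ultimately show ?thesis by (rule bdd_above_mono)
qed

section \<open>Uniqueness of Fourier series\<close>

text \<open>The set of continuous functions orthogonal to all waves is stable under multiplication by
  the functions that Stone--Weierstrass supplies.\<close>

definition fourier_null :: "real \<Rightarrow> (real \<Rightarrow> complex) \<Rightarrow> bool" where
  "fourier_null P g \<longleftrightarrow> continuous_on {- (P / 2)..P / 2} g \<and>
     (\<forall>k. integral {- (P / 2)..P / 2} (\<lambda>t. g t * wave P k t) = 0)"

lemma fourier_null_add:
  assumes "fourier_null P f" "fourier_null P g"
  shows "fourier_null P (\<lambda>t. f t + g t)"
proof -
  have "(\<lambda>t. f t * wave P k t) integrable_on {- (P / 2)..P / 2}"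
       "(\<lambda>t. g t * wave P k t) integrable_on {- (P / 2)..P / 2}" for k
    using assms by (auto simp: fourier_null_def intro!: integrable_continuous_real continuous_intros)
  then show ?thesis
    using assms
    by (auto simp: fourier_null_def ring_distribs Henstock_Kurzweil_Integration.integral_add
        intro!: continuous_intros)
qed

lemma fourier_null_mult_wave:
  assumes "fourier_null P f"
  shows "fourier_null P (\<lambda>t. c * wave P j t * f t)"
proof -
  have "(\<lambda>t. c * wave P j t * f t * wave P k t) = (\<lambda>t. c * (f t * wave P (j + k) t))" for k
    by (auto simp: fun_eq_iff wave_mult[symmetric])
  then show ?thesis
    using assms by (auto simp: fourier_null_def intro!: continuous_intros)
qed

text \<open>A linear \<open>r\<close> on the plane, evaluated on the circle, combines the waves of
  frequency 1 and -1, and multiplying by a wave only permutes the orthogonality conditions. Products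
  apply both induction hypotheses in turn, hence the generalisation over \<open>f\<close>.\<close>

lemma fourier_null_mult_polynomial:
  assumes "real_polynomial_function r" "fourier_null P f"
  shows "fourier_null P (\<lambda>t. of_real (r (wave P 1 t)) * f t)"
  using assms
proof (induction arbitrary: f)
  case (linear r)
  have r: "r z = Re z * r 1 + Im z * r \<i>" for z
  proof -
    interpret bounded_linear r by fact
    have "z = Re z *\<^sub>R 1 + Im z *\<^sub>R \<i>" by (simp add: complex_eq_iff)
    then have "r z = r (Re z *\<^sub>R 1 + Im z *\<^sub>R \<i>)" by simp
    then show ?thesis by (simp only: add scaleR real_scaleR_def)
  qed
  \<comment> \<open>From \<open>Re z = (z + cnj z) / 2\<close> and
    \<open>Im z = (z - cnj z) / (2 * \<i>)\<close>, where the conjugate of \<open>wave P 1 t\<close>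
    is \<open>wave P (- 1) t\<close>.\<close>
  define \<alpha> where "\<alpha> = (complex_of_real (r 1) - \<i> * of_real (r \<i>)) / 2"
  define \<beta> where "\<beta> = (complex_of_real (r 1) + \<i> * of_real (r \<i>)) / 2"
  have "of_real (r (wave P 1 t)) = \<alpha> * wave P 1 t + \<beta> * wave P (- 1) t" for t
    unfolding cnj_wave[symmetric] \<alpha>_def \<beta>_def by (subst r) (simp add: complex_eq_iff field_simps)
  then have "(\<lambda>t. of_real (r (wave P 1 t)) * f t) =
      (\<lambda>t. \<alpha> * wave P 1 t * f t + \<beta> * wave P (- 1) t * f t)"
    by (simp add: ring_distribs)
  then show ?case
    using linear by (auto intro!: fourier_null_add fourier_null_mult_wave)
next
  case (const c)
  then show ?case using fourier_null_mult_wave[OF const, of "of_real c" 0] by simp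
next
  case (add r s)
  then show ?case by (auto simp: ring_distribs intro!: fourier_null_add)
next
  case (mult r s)
  from mult.IH(1)[OF mult.IH(2)[OF mult.prems]] show ?case by (simp add: mult.assoc)
qed

text \<open>\<open>G\<close> reads \<open>g\<close> along the argument. \<open>Arg\<close> jumps
  across the negative real axis, \<open>Arg2pi\<close> across the positive one; by periodicity both
  yield the same \<open>G\<close>, so at every nonzero point one of the two formulas is
  continuous.\<close>

lemma continuous_periodic_on_circle:
  fixes g :: "real \<Rightarrow> real"
  assumes P: "P > 0" and per: "\<And>t. g (t + P) = g t" and cont: "continuous_on UNIV g"
  obtains G where "continuous_on (sphere 0 1) G" "\<And>t. G (wave P 1 t) = g t"
proof
  have gcont: "isCont g x" for x using cont by (simp add: continuous_on_eq_continuous_at)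
  define G where "G z = g (P * Arg z / (2 * pi))" for z
  have *: "g (P * s / (2 * pi)) = g (P * t / (2 * pi))" if "cis s = cis t" for s t
  proof -
    from that have "cis (s - t) = 1" by (simp add: cis_divide[symmetric])
    then have "cos (s - t) = 1" by (simp add: complex_eq_iff)
    then obtain n :: int where "s - t = 2 * pi * of_int n"
      using cos_one_2pi_int by (metis mult.commute mult.left_commute)
    then have "s = t + 2 * pi * of_int n" by simp
    then have "P * s / (2 * pi) = P * t / (2 * pi) + of_int n * P"
      by (simp add: field_simps)
    then show ?thesis using periodic_of_int[of g P, OF per] by simp
  qed
  show "G (wave P 1 t) = g t" for t
  proof -
    have "wave P 1 t \<noteq> 0" by (metis norm_wave norm_zero zero_neq_one)
    then have "cis (Arg (wave P 1 t)) = wave P 1 t" by (simp add: cis_Arg sgn_div_norm)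
    then have "cis (Arg (wave P 1 t)) = cis (2 * pi / P * t)" by (simp add: wave_def)
    from *[OF this] show ?thesis using P by (simp add: G_def)
  qed
  have G2: "G z = g (P * Arg2pi z / (2 * pi))" if "z \<noteq> 0" for z
  proof -
    have "cis (Arg z) = z / of_real (norm z)"
      using that by (simp add: cis_Arg sgn_eq)
    also have "\<dots> = cis (Arg2pi z)"
      unfolding cis_conv_exp using Arg2pi_eq[of z] that
      by (metis nonzero_mult_div_cancel_left norm_eq_zero of_real_eq_0_iff)
    finally show ?thesis unfolding G_def by (rule *)
  qed
  have "isCont G z" if "z \<noteq> 0" for z
  proof (cases "z \<in> \<real>\<^sub>\<le>\<^sub>0")
    case False
    then have "isCont (\<lambda>z. P * Arg z / (2 * pi)) z"
      using continuous_at_Arg[OF False] by (intro continuous_intros) auto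
    then show ?thesis unfolding G_def by (rule isCont_o2[OF _ gcont])
  next
    case True
    with that have "z \<notin> \<real>\<^sub>\<ge>\<^sub>0"
      by (auto simp: complex_nonpos_Reals_iff complex_nonneg_Reals_iff complex_eq_iff)
    from continuous_at_Arg2pi[OF this] have "isCont (\<lambda>z. P * Arg2pi z / (2 * pi)) z"
      by (intro continuous_intros) auto
    then have cont2: "isCont (\<lambda>z. g (P * Arg2pi z / (2 * pi))) z"
      by (rule isCont_o2[OF _ gcont])
    have "eventually (\<lambda>w. w \<noteq> 0) (nhds z)" using that by (rule t1_space_nhds)
    then have "eventually (\<lambda>w. G w = g (P * Arg2pi w / (2 * pi))) (nhds z)"
      by eventually_elim (rule G2)
    from isCont_cong[OF this] cont2 show ?thesis by simp
  qed
  then show "continuous_on (sphere 0 1) G"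
    by (metis continuous_at_imp_continuous_on mem_sphere_0 norm_zero zero_neq_one)
qed

text \<open>Take a polynomial \<open>r\<close> on the circle uniformly within \<open>e\<close> of
  \<open>g\<close>. As \<open>r\<close> is orthogonal to \<open>g\<close>, the integral of
  \<open>g^2\<close> equals that of \<open>(g - r) * g\<close> and is at most \<open>e\<close> times
  the integral of \<open>\<bar>g\<bar>\<close>. Letting \<open>e\<close> tend to 0 forces the
  continuous function \<open>g\<close> to vanish.\<close>

lemma fourier_null_eq_0:
  fixes g :: "real \<Rightarrow> real"
  assumes P: "P > 0" and per: "\<And>t. g (t + P) = g t" and cont: "continuous_on UNIV g"
    and null: "fourier_null P (\<lambda>t. of_real (g t))"
  shows "g t = 0"
proof -
  let ?I = "{- (P / 2)..P / 2}"
  obtain G where G: "continuous_on (sphere 0 1) G" "\<And>t. G (wave P 1 t) = g t"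
    using continuous_periodic_on_circle[OF P per cont] by blast
  have contI: "continuous_on ?I g" using cont continuous_on_subset by blast
  have le: "integral ?I (\<lambda>t. (g t)\<^sup>2) \<le> e * integral ?I (\<lambda>t. \<bar>g t\<bar>)" if e: "e > 0" for e
  proof -
    obtain r where r: "real_polynomial_function r" "\<And>z. z \<in> sphere 0 1 \<Longrightarrow> \<bar>G z - r z\<bar> < e"
      using Stone_Weierstrass_real_polynomial_function[OF compact_sphere G(1) e] by blast
    let ?r = "\<lambda>t. r (wave P 1 t)"
    have close: "\<bar>g t - ?r t\<bar> < e" for t using r(2)[of "wave P 1 t"] G(2) by simp
    have contr: "continuous_on ?I ?r"
      using r(1) by (intro continuous_on_compose2[OF continuous_on_polymonial_function[of r UNIV]])
         (auto intro: continuous_intros simp: real_polynomial_function_eq)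
    \<comment> \<open>Orthogonality of \<open>?r\<close> and \<open>g\<close> is the frequency 0
      case of \<open>fourier_null\<close> for their product.\<close>
    have "integral ?I (\<lambda>t. complex_of_real (?r t) * of_real (g t)) = 0"
      using fourier_null_mult_polynomial[OF r(1) null] unfolding fourier_null_def
      by (auto dest: spec[of _ 0])
    moreover have "integral ?I (complex_of_real \<circ> (\<lambda>t. ?r t * g t)) =
        complex_of_real (integral ?I (\<lambda>t. ?r t * g t))"
      by (intro integral_linear bounded_linear_of_real integrable_continuous_real
          continuous_on_mult contr contI)
    ultimately have "complex_of_real (integral ?I (\<lambda>t. ?r t * g t)) = 0"
      by (simp add: o_def)
    then have 0: "integral ?I (\<lambda>t. ?r t * g t) = 0" by simp
    have "integral ?I (\<lambda>t. (g t)\<^sup>2) = integral ?I (\<lambda>t. (g t)\<^sup>2) - integral ?I (\<lambda>t. ?r t * g t)"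
      using 0 by simp
    also have "\<dots> = integral ?I (\<lambda>t. (g t)\<^sup>2 - ?r t * g t)"
      by (rule Henstock_Kurzweil_Integration.integral_diff[symmetric])
         (auto intro!: integrable_continuous_real continuous_intros contr contI)
    also have "\<dots> \<le> integral ?I (\<lambda>t. e * \<bar>g t\<bar>)"
    proof (rule integral_le)
      fix t
      have "(g t)\<^sup>2 - ?r t * g t \<le> \<bar>g t - ?r t\<bar> * \<bar>g t\<bar>"
        by (subst abs_mult[symmetric]) (auto simp: power2_eq_square algebra_simps)
      also have "\<dots> \<le> e * \<bar>g t\<bar>" using close[of t] by (intro mult_right_mono) auto
      finally show "(g t)\<^sup>2 - ?r t * g t \<le> e * \<bar>g t\<bar>" .
    qed (auto intro!: integrable_continuous_real continuous_intros contr contI)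
    finally show ?thesis by simp
  qed
  have nonneg: "integral ?I (\<lambda>t. \<bar>g t\<bar>) \<ge> 0"
    by (intro integral_nonneg integrable_continuous_real continuous_intros contI) auto
  have "integral ?I (\<lambda>t. (g t)\<^sup>2) \<le> 0"
  proof (rule field_le_epsilon)
    fix e :: real assume e: "e > 0"
    let ?A = "integral ?I (\<lambda>t. \<bar>g t\<bar>)"
    \<comment> \<open>The added 1 keeps the divisor positive when \<open>?A\<close> is 0.\<close>
    have "integral ?I (\<lambda>t. (g t)\<^sup>2) \<le> e / (?A + 1) * ?A" using le[of "e / (?A + 1)"] e nonneg by simp
    also have "\<dots> \<le> e" using e nonneg by (simp add: field_simps)
    finally show "integral ?I (\<lambda>t. (g t)\<^sup>2) \<le> 0 + e" by simp
  qed
  moreover have "integral ?I (\<lambda>t. (g t)\<^sup>2) \<ge> 0"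
    by (intro integral_nonneg integrable_continuous_real continuous_intros contI) auto
  ultimately have "\<forall>t\<in>?I. (g t)\<^sup>2 = 0"
    using P contI by (subst integral_eq_0_iff[symmetric]) (auto intro!: continuous_intros)
  moreover obtain s where "s \<in> ?I" "g s = g t" using periodic_reduce[of P g, OF P per] by blast
  ultimately show ?thesis by auto
qed

section \<open>Decay of the Fourier coefficients\<close>

lemma total_variationD:
  assumes "total_variation g a b \<le> ereal V" "t 0 = a" "t n = b" "\<And>i. i < n \<Longrightarrow> t i \<le> t (Suc i)"
  shows "(\<Sum>i<n. \<bar>g (t (Suc i)) - g (t i)\<bar>) \<le> V"
proof -
  have "ereal (\<Sum>i<n. \<bar>g (t (Suc i)) - g (t i)\<bar>) \<le> total_variation g a b"
    unfolding total_variation_def using assms(2-4)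
    by (intro SUP_upper2[of "(n, t)"]) auto
  with assms(1) show ?thesis by (metis ereal_less_eq(3) order_trans)
qed

lemma total_variation_dist_le:
  assumes "total_variation g a b \<le> ereal V" "x \<in> {a..b}"
  shows "\<bar>g x - g a\<bar> \<le> V"
proof -
  let ?t = "\<lambda>i::nat. if i = 0 then a else if i = 1 then x else b"
  have "(\<Sum>i<2. \<bar>g (?t (Suc i)) - g (?t i)\<bar>) \<le> V"
    using assms by (intro total_variationD[OF assms(1)]) auto
  then show ?thesis by (simp add: numeral_2_eq_2)
qed

text \<open>All steps but the last stay within the period and belong to a partition of it. The last
  one wraps around to \<open>s\<close>; by the triangle inequality through the common value of
  \<open>u\<close> at both endpoints it is at most the first plus the last term of that
  partition.\<close>

lemma cyclic_variation_le:
  assumes P: "P > 0" and per: "\<And>t. u (t + P) = u t"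
    and tv: "total_variation u (- (P / 2)) (P / 2) \<le> ereal V"
    and h: "real N * h = P" and s: "s \<in> {- (P / 2)..- (P / 2) + h}"
  shows "(\<Sum>j<N. \<bar>u (s + real j * h + h) - u (s + real j * h)\<bar>) \<le> V"
proof -
  obtain M where N: "N = Suc M" using P h by (cases N) auto
  have "real N * h > 0" using P by (simp add: h)
  then have hpos: "h > 0" by (simp add: zero_less_mult_iff)
  have Mh: "real M * h + h = P" using h N by (simp add: ring_distribs)
  \<comment> \<open>The \<open>N\<close> points are moved up by one index to make room for the left
    endpoint; index \<open>Suc N\<close> is the right endpoint.\<close>
  let ?t = "\<lambda>i. if i = 0 then - (P / 2) else if i \<le> N then s + real (i - 1) * h else P / 2"
  let ?v = "\<lambda>i. \<bar>u (?t (Suc i)) - u (?t i)\<bar>"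
  have "(\<Sum>i<Suc N. ?v i) \<le> V"
  proof (rule total_variationD[OF tv])
    fix i assume "i < Suc N"
    then consider "i = 0" | "0 < i" "i < N" | "i = N" by linarith
    then show "?t i \<le> ?t (Suc i)"
    proof cases
      case 2
      then have "real (i - 1) \<le> real i" by simp
      with hpos have "real (i - 1) * h \<le> real i * h" by (intro mult_right_mono) auto
      with 2 show ?thesis by simp
    next
      case 3
      then show ?thesis using N s Mh by auto
    qed (use s N in auto)
  qed auto
  moreover have "(\<Sum>i<Suc N. ?v i) = \<bar>u s - u (- (P / 2))\<bar> + (\<Sum>i<M. ?v (Suc i)) + \<bar>u (P / 2) - u (s + real M * h)\<bar>"
    unfolding N by (subst sum.lessThan_Suc_shift) simp
  moreover have "(\<Sum>i<M. ?v (Suc i)) = (\<Sum>j<M. \<bar>u (s + real j * h + h) - u (s + real j * h)\<bar>)"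
    by (rule sum.cong) (auto simp: N algebra_simps)
  moreover have "u (P / 2) = u (- (P / 2))" using per[of "- (P / 2)"] by simp
  moreover have "u (s + real M * h + h) = u s"
    using per[of s] Mh by (simp add: add.assoc)
  ultimately show ?thesis unfolding N by simp
qed

lemma integral_split_shift:
  fixes w :: "real \<Rightarrow> real"
  assumes "h \<ge> 0" "w integrable_on {a..a + real N * h}"
  shows "integral {a..a + real N * h} w = (\<Sum>j<N. integral {a..a + h} (\<lambda>s. w (s + real j * h)))"
    and "\<And>j. j < N \<Longrightarrow> (\<lambda>s. w (s + real j * h)) integrable_on {a..a + h}"
proof -
  have sub: "{a + real j * h..a + real j * h + h} \<subseteq> {a..a + real N * h}" if "j < N" for j
  proof -
    have "(real j + 1) * h \<le> real N * h" using that assms(1) by (intro mult_right_mono) auto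
    moreover have "real j * h \<ge> 0" using assms(1) by simp
    ultimately show ?thesis by (auto simp: algebra_simps)
  qed
  have shift: "((\<lambda>s. w (s + real j * h)) has_integral integral {a + real j * h..a + real j * h + h} w)
      {a..a + h}" if "j < N" for j
  proof -
    have "(w has_integral integral {a + real j * h..a + real j * h + h} w)
        {a + real j * h..a + h + real j * h}"
      using integrable_integral[OF integrable_on_subinterval[OF assms(2) sub[OF that]]]
      by (simp add: add_ac)
    then show ?thesis
      using has_integral_shift_Icc_real[of w "real j * h" _ a "a + h"] by (simp add: o_def add.commute)
  qed
  then show "\<And>j. j < N \<Longrightarrow> (\<lambda>s. w (s + real j * h)) integrable_on {a..a + h}"
    by (auto simp: integrable_on_def)
  \<comment> \<open>The induction runs over \<open>n \<le> N\<close> with \<open>N\<close> fixed, so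
    that integrability on the whole range stays available.\<close>
  have "integral {a..a + real n * h} w = (\<Sum>j<n. integral {a + real j * h..a + real j * h + h} w)"
    if "n \<le> N" for n using that
  proof (induction n)
    case (Suc n)
    have "w integrable_on {a..a + real (Suc n) * h}"
      using Suc.prems assms(1) by (intro integrable_on_subinterval[OF assms(2)]) (auto intro!: mult_right_mono)
    then have "integral {a..a + real (Suc n) * h} w =
        integral {a..a + real n * h} w + integral {a + real n * h..a + real (Suc n) * h} w"
      using assms(1) by (intro Henstock_Kurzweil_Integration.integral_combine[symmetric])
        (auto intro!: mult_right_mono)
    moreover have "a + real (Suc n) * h = a + real n * h + h" by (simp add: algebra_simps)
    ultimately show ?case using Suc by (simp only: sum.lessThan_Suc)
  qed auto
  then show "integral {a..a + real N * h} w =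
      (\<Sum>j<N. integral {a..a + h} (\<lambda>s. w (s + real j * h)))"
    using integral_unique[OF shift] by simp
qed

text \<open>Folding the period onto one cell of length \<open>h\<close> turns the integrand into a
  sum of \<open>N\<close> consecutive increments, which \<open>cyclic_variation_le\<close> bounds by
  \<open>V\<close> at every point of the cell.\<close>

lemma integral_abs_difference_le:
  fixes u :: "real \<Rightarrow> real"
  assumes P: "P > 0" and per: "\<And>t. u (t + P) = u t"
    and tv: "total_variation u (- (P / 2)) (P / 2) \<le> ereal V"
    and int: "u integrable_on {- (P / 2)..P / 2}" and N: "N > 0" and h: "h = P / real N"
  shows "(\<lambda>t. \<bar>u (t + h) - u t\<bar>) integrable_on {- (P / 2)..P / 2}"
    and "integral {- (P / 2)..P / 2} (\<lambda>t. \<bar>u (t + h) - u t\<bar>) \<le> h * V"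
proof -
  let ?I = "{- (P / 2)..P / 2}" and ?w = "\<lambda>t. \<bar>u (t + h) - u t\<bar>"
  have h0: "0 < h" "h \<le> P" and Nh: "real N * h = P" using P N by (auto simp: h field_simps)
  have I: "?I = {- (P / 2)..- (P / 2) + real N * h}" "?I = {- (P / 2)..- (P / 2) + P}"
    using Nh by simp_all
  have shifted: "(\<lambda>t. u (t + h)) integrable_on ?I"
    using periodic_has_integral_shift[of P u "- (P / 2)" h] P per int h0
    unfolding I(2) by (auto simp: integrable_on_def)
  have d: "(\<lambda>t. u (t + h) - u t) integrable_on ?I" by (rule integrable_diff[OF shifted int])
  have dist: "\<bar>u x - u (- (P / 2))\<bar> \<le> V" for x
    using total_variation_dist_le[OF tv] periodic_reduce[of P u x, OF P per] by metis
  \<comment> \<open>A gauge integrable function may fail to be absolutely integrable; boundedness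
    rules this out here.\<close>
  have "norm (u (t + h) - u t) \<le> 2 * V" for t
    using dist[of t] dist[of "t + h"] by simp
  then have "(\<lambda>t. u (t + h) - u t) absolutely_integrable_on ?I"
    by (intro absolutely_integrable_integrable_bound[OF _ d, where g = "\<lambda>_. 2 * V"]) auto
  then show w: "?w integrable_on ?I"
    by (simp add: absolutely_integrable_on_def)
  have "integral ?I ?w = (\<Sum>j<N. integral {- (P / 2)..- (P / 2) + h} (\<lambda>s. ?w (s + real j * h)))"
    using integral_split_shift(1)[of h ?w "- (P / 2)" N] h0 w unfolding I(1) by simp
  also have "\<dots> = integral {- (P / 2)..- (P / 2) + h} (\<lambda>s. \<Sum>j<N. ?w (s + real j * h))"
    using integral_split_shift(2)[of h ?w "- (P / 2)" N] h0 w unfolding I(1)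
    by (subst integral_sum) auto
  also have "\<dots> \<le> integral {- (P / 2)..- (P / 2) + h} (\<lambda>s. V)"
  proof (rule integral_le)
    show "(\<lambda>s. \<Sum>j<N. ?w (s + real j * h)) integrable_on {- (P / 2)..- (P / 2) + h}"
      using integral_split_shift(2)[of h ?w "- (P / 2)" N] h0 w unfolding I(1)
      by (intro integrable_sum) auto
    show "(\<Sum>j<N. ?w (s + real j * h)) \<le> V" if "s \<in> {- (P / 2)..- (P / 2) + h}" for s
      using cyclic_variation_le[of P u V N h s, OF P per tv Nh that] .
  qed auto
  also have "\<dots> = h * V" using h0 by simp
  finally show "integral ?I ?w \<le> h * V" .
qed

text \<open>This is the derivative of \<open>exp\<close> at 0, taken along the points
  \<open>\<i> * c / Suc n\<close> and passed through the norm.\<close>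

lemma cis_difference_quotient:
  assumes "c \<noteq> 0"
  shows "(\<lambda>n. norm (cis (c / real (Suc n)) - 1) * real (Suc n) / \<bar>c\<bar>) \<longlonglongrightarrow> 1"
proof -
  have 1: "((\<lambda>z::complex. (exp z - 1) / z) \<longlongrightarrow> 1) (at 0)"
    using DERIV_exp[of "0::complex"] by (simp add: DERIV_def)
  let ?z = "\<lambda>n. \<i> * complex_of_real (c / real (Suc n))"
  have "(\<lambda>n. c / real (Suc n)) \<longlonglongrightarrow> 0"
    by (rule real_tendsto_divide_at_top[OF tendsto_const])
       (rule filterlim_compose[OF filterlim_real_sequentially filterlim_Suc])
  from tendsto_mult[OF tendsto_const tendsto_of_real[OF this, where 'a = complex], of \<i>]
  have "?z \<longlonglongrightarrow> 0" by simp
  then have "filterlim ?z (at 0) sequentially"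
    using assms by (auto simp: filterlim_at simp del: of_nat_Suc)
  from filterlim_compose[OF 1 this]
  have "(\<lambda>n. (exp (?z n) - 1) / ?z n) \<longlonglongrightarrow> 1" .
  moreover have "norm ((exp (?z n) - 1) / ?z n) = norm (cis (c / real (Suc n)) - 1) * real (Suc n) / \<bar>c\<bar>" for n
    by (simp add: cis_conv_exp norm_divide norm_mult del: of_nat_Suc)
  ultimately show ?thesis using tendsto_norm by fastforce
qed

text \<open>Translating \<open>u\<close> by \<open>h = P / N\<close> multiplies its coefficient by \<open>wave P k h\<close>, while the translate
  differs from \<open>u\<close> by at most \<open>h * V\<close> in \<open>L\<^sup>1\<close>. Dividing by \<open>h\<close> and letting \<open>N\<close> grow yields the sharp
  constant without a Stieltjes integral.\<close>

lemma norm_fourier_coeff_bounded_variation: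
  fixes u :: "real \<Rightarrow> real"
  assumes P: "P > 0" and per: "\<And>t. u (t + P) = u t"
    and tv: "total_variation u (- (P / 2)) (P / 2) \<le> ereal V"
    and int: "\<And>k. (\<lambda>t. complex_of_real (u t) * wave P k t) integrable_on {- (P / 2)..P / 2}"
    and k: "k \<noteq> 0"
  shows "norm (fourier_coeff P u k) \<le> V / (2 * pi * \<bar>of_int k\<bar>)"
proof -
  let ?I = "{- (P / 2)..P / 2}" and ?c = "fourier_coeff P u k"
  have intu: "u integrable_on ?I"
    using integrable_linear[OF int[of 0] bounded_linear_Re] by (simp add: o_def)
  have *: "norm (wave P k (P / real (Suc n)) - 1) * real (Suc n) * norm ?c \<le> V" for n
  proof -
    define h where "h = P / real (Suc n)"
    have h: "0 < h" "h \<le> P" using P by (auto simp: h_def field_simps)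
    have "((\<lambda>t. complex_of_real (u (t + h)) * wave P (- k) t) has_integral
        of_real P * wave P k h * ?c) ?I"
      using h P per int by (intro fourier_coeff_shift) auto
    moreover have "((\<lambda>t. complex_of_real (u t) * wave P (- k) t) has_integral of_real P * ?c) ?I"
      using integrable_integral[OF int[of "- k"]] P by (simp add: fourier_coeff_def)
    ultimately have "((\<lambda>t. complex_of_real (u (t + h)) * wave P (- k) t - complex_of_real (u t) * wave P (- k) t)
        has_integral of_real P * wave P k h * ?c - of_real P * ?c) ?I"
      by (rule has_integral_diff)
    then have d: "((\<lambda>t. complex_of_real (u (t + h) - u t) * wave P (- k) t) has_integral
        of_real P * (wave P k h - 1) * ?c) ?I"
      by (simp add: algebra_simps)
    have "norm (of_real P * (wave P k h - 1) * ?c) =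
        norm (integral ?I (\<lambda>t. complex_of_real (u (t + h) - u t) * wave P (- k) t))"
      using d by (simp add: integral_unique)
    also have "\<dots> \<le> integral ?I (\<lambda>t. \<bar>u (t + h) - u t\<bar>)"
      using d integral_abs_difference_le(1)[of P u V "Suc n" h, OF P per tv intu]
      by (intro integral_norm_bound_integral) (auto simp: h_def norm_mult integrable_on_def simp flip: of_real_diff)
    also have "\<dots> \<le> h * V"
      using integral_abs_difference_le(2)[of P u V "Suc n" h, OF P per tv intu] by (simp add: h_def)
    finally have "P * (norm (wave P k h - 1) * norm ?c) \<le> h * V"
      using P by (simp add: norm_mult mult.assoc)
    then show ?thesis using P by (simp add: h_def field_simps del: of_nat_Suc)
  qed
  \<comment> \<open>At \<open>h = P / Suc n\<close> the period cancels and the wave is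
    \<open>cis (?a / Suc n)\<close>, so \<open>norm (wave P k h - 1) * Suc n\<close> tends to
    \<open>\<bar>?a\<bar>\<close>.\<close>
  let ?a = "2 * pi * of_int k"
  have a: "?a \<noteq> 0" using k by simp
  have "norm ?c * (norm (cis (?a / real (Suc n)) - 1) * real (Suc n) / \<bar>?a\<bar>) \<le> V / \<bar>?a\<bar>" for n
    using *[of n] P a by (simp add: wave_def divide_right_mono mult_ac del: of_nat_Suc)
  moreover have "(\<lambda>n. norm ?c * (norm (cis (?a / real (Suc n)) - 1) * real (Suc n) / \<bar>?a\<bar>)) \<longlonglongrightarrow> norm ?c * 1"
    by (intro tendsto_mult tendsto_const cis_difference_quotient a)
  ultimately have "norm ?c * 1 \<le> V / \<bar>?a\<bar>"
    by (intro LIMSEQ_le_const2) auto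
  then show ?thesis by (simp add: abs_mult)
qed

section \<open>Derivatives of periodic functions and the decay rate\<close>

text \<open>The same numbers are derivatives at \<open>t\<close> and at \<open>t + P\<close>, so
  \<open>deriv\<close> picks equal values, even where \<open>f\<close> is not
  differentiable.\<close>

lemma deriv_periodic:
  fixes f :: "real \<Rightarrow> real"
  assumes "\<And>t. f (t + P) = f t"
  shows "deriv f (t + P) = deriv f t"
proof -
  have "(f has_field_derivative D) (at (t + P)) \<longleftrightarrow> (f has_field_derivative D) (at t)" for D
    using DERIV_shift[of f D t P] assms by simp
  then show ?thesis by (simp add: deriv_def)
qed

lemma higher_deriv_periodic:
  fixes f :: "real \<Rightarrow> real"
  assumes "\<And>t. f (t + P) = f t"
  shows "(deriv ^^ n) f (t + P) = (deriv ^^ n) f t"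
  by (induction n arbitrary: t) (auto simp: assms deriv_periodic)

lemma fourier_coeff_higher_deriv:
  fixes f :: "real \<Rightarrow> real"
  assumes P: "P > 0" and per: "\<And>t. f (t + P) = f t"
    and diff: "\<And>j x. j < n \<Longrightarrow> (deriv ^^ j) f differentiable (at x)"
  shows "fourier_coeff P ((deriv ^^ n) f) k =
    (\<i> * of_real (2 * pi * of_int k / P)) ^ n * fourier_coeff P f k"
  using diff
proof (induction n)
  case (Suc n)
  have "((deriv ^^ n) f has_real_derivative (deriv ^^ Suc n) f t) (at t)" for t
    using Suc.prems by (simp add: DERIV_deriv_iff_real_differentiable)
  moreover from this have "continuous_on UNIV ((deriv ^^ n) f)"
    by (intro continuous_at_imp_continuous_on) (auto intro: DERIV_isCont)
  ultimately have "fourier_coeff P ((deriv ^^ Suc n) f) k =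
      \<i> * of_real (2 * pi * of_int k / P) * fourier_coeff P ((deriv ^^ n) f) k"
    using higher_deriv_periodic[of f P, OF per]
    by (intro fourier_coeff_derivative(2)[OF P _ _ finite.emptyI]) auto
  with Suc show ?case by simp
qed simp

text \<open>Integrating by parts \<open>q\<close> times multiplies the coefficient by
  \<open>(2 * pi * \<i> * k / P) ^ q\<close> and leads to the coefficient of the \<open>q\<close>-th
  derivative, which its variation controls.\<close>

lemma norm_fourier_coeff_decay:
  fixes f :: "real \<Rightarrow> real"
  assumes P: "P > 0" and per: "\<And>t. f (t + P) = f t" and q: "q \<ge> 1"
    and diff: "\<And>j x. j < q - 1 \<Longrightarrow> (deriv ^^ j) f differentiable (at x)"
    and cont: "continuous_on UNIV ((deriv ^^ (q - 1)) f)"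
    and var: "qth_derivative_variation_le q P f V" and k: "k \<noteq> 0"
  shows "norm (fourier_coeff P f k) \<le> V / (2 * pi * \<bar>of_int k\<bar>) * (P / (2 * pi * \<bar>of_int k\<bar>)) ^ q"
proof -
  let ?g = "(deriv ^^ (q - 1)) f" and ?w = "\<i> * complex_of_real (2 * pi * of_int k / P)"
  obtain u where u: "periodic_fun_simple u P" "derivative_except_breaks ?g u"
      "total_variation u (- (P / 2)) (P / 2) \<le> ereal V"
    using var by (auto simp: qth_derivative_variation_le_def)
  have peru: "u (t + P) = u t" for t using u(1) by (rule periodic_fun_simple.plus_period)
  have Sq: "Suc (q - 1) = q" using q by simp
  define S where "S = {x \<in> {- (P / 2)..P / 2}. \<not> ?g differentiable (at x)}"
  have S: "finite S" using u(2) unfolding derivative_except_breaks_def S_def by blast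
  have der: "(?g has_real_derivative u t) (at t)" if "t \<in> {- (P / 2)<..<P / 2} - S" for t
    using that u(2) by (auto simp: derivative_except_breaks_def S_def simp del: One_nat_def)
  \<comment> \<open>The \<open>q\<close>-th integration by parts goes through \<open>u\<close>,
    which is the derivative of \<open>?g\<close> only off the finite set \<open>S\<close>.\<close>
  note * = fourier_coeff_derivative[OF P higher_deriv_periodic[of f P, OF per] cont S der]
  have "(\<lambda>t. complex_of_real (u t) * wave P j t) integrable_on {- (P / 2)..P / 2}" for j
    using *(1)[of "- j"] by simp
  from norm_fourier_coeff_bounded_variation[of P u, OF P peru u(3) this k]
  have "norm (?w ^ Suc (q - 1) * fourier_coeff P f k) \<le> V / (2 * pi * \<bar>of_int k\<bar>)"
    using *(2)[of k] fourier_coeff_higher_deriv[of P f "q - 1", OF P per diff] by (simp add: mult.assoc)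
  moreover have "norm ?w = 2 * pi * \<bar>of_int k\<bar> / P"
    using P by (simp add: norm_mult norm_divide abs_mult)
  ultimately have "(2 * pi * \<bar>of_int k\<bar> / P) ^ q * norm (fourier_coeff P f k) \<le> V / (2 * pi * \<bar>of_int k\<bar>)"
    by (simp only: norm_mult norm_power Sq)
  moreover have "(2 * pi * \<bar>of_int k\<bar> / P) ^ q > 0" using P k by simp
  ultimately have "norm (fourier_coeff P f k) \<le>
      V / (2 * pi * \<bar>of_int k\<bar>) / (2 * pi * \<bar>of_int k\<bar> / P) ^ q"
    by (subst pos_le_divide_eq) (simp_all only: mult.commute)
  then show ?thesis by (simp add: power_divide)
qed

section \<open>Convergence and truncation of the Fourier series\<close>

lemma cnj_fourier_coeff: "cnj (fourier_coeff P f k) = fourier_coeff P f (- k)"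
  by (simp only: fourier_coeff_def complex_cnj_divide integral_cnj complex_cnj_mult cnj_wave
      complex_cnj_complex_of_real)

text \<open>The frequencies \<open>n\<close> and \<open>- n\<close> are paired, which gives a real
  function. Frequency 0 would be counted twice, so the series use \<open>Suc n\<close> and add the
  constant term separately.\<close>

definition fourier_term :: "real \<Rightarrow> (real \<Rightarrow> real) \<Rightarrow> nat \<Rightarrow> real \<Rightarrow> real" where
  "fourier_term P f n t = 2 * Re (fourier_coeff P f (int n) * wave P (int n) t)"

lemma of_real_fourier_term:
  "complex_of_real (fourier_term P f n t) =
    fourier_coeff P f (int n) * wave P (int n) t + fourier_coeff P f (- int n) * wave P (- int n) t"
proof -
  have "fourier_coeff P f (- int n) * wave P (- int n) t = cnj (fourier_coeff P f (int n) * wave P (int n) t)"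
    by (simp only: complex_cnj_mult cnj_fourier_coeff cnj_wave)
  then show ?thesis by (simp only: fourier_term_def complex_add_cnj)
qed

lemma abs_fourier_term_le: "\<bar>fourier_term P f n t\<bar> \<le> 2 * norm (fourier_coeff P f (int n))"
proof -
  have "\<bar>Re (fourier_coeff P f (int n) * wave P (int n) t)\<bar> \<le> norm (fourier_coeff P f (int n))"
    by (rule order_trans[OF abs_Re_le_cmod]) (simp add: norm_mult)
  then show ?thesis unfolding fourier_term_def by linarith
qed

lemma fourier_term_has_integral:
  assumes P: "P > 0"
  shows "((\<lambda>t. complex_of_real (fourier_term P f n t) * wave P k t) has_integral
    of_real P * ((if int n + k = 0 then fourier_coeff P f (int n) else 0) +
      (if k = int n then fourier_coeff P f (- int n) else 0))) {- (P / 2)..P / 2}"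
proof -
  have w: "((\<lambda>t. c * wave P j t) has_integral c * (if j = 0 then of_real P else 0)) {- (P / 2)..P / 2}"
    for c j
    by (subst integral_wave[OF P, symmetric]) (intro has_integral_mult_right integrable_integral
        integrable_continuous_real continuous_on_wave)
  have "complex_of_real (fourier_term P f n t) * wave P k t =
      fourier_coeff P f (int n) * wave P (int n + k) t +
      fourier_coeff P f (- int n) * wave P (- int n + k) t" for t
    by (simp only: of_real_fourier_term ring_distribs mult.assoc wave_mult)
  then show ?thesis
    by (simp only:) (rule has_integral_eq_rhs[OF has_integral_add[OF w w]], auto simp: mult.commute)
qed

text \<open>The Weierstrass test gives a continuous uniform limit \<open>L\<close>. Uniform
  convergence lets integrals pass to the limit, so \<open>f\<close> minus the constant term minus
  \<open>L\<close> is orthogonal to all waves and vanishes by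
  \<open>fourier_null_eq_0\<close>.\<close>

theorem fourier_series_sums:
  fixes f :: "real \<Rightarrow> real"
  assumes P: "P > 0" and per: "\<And>t. f (t + P) = f t" and cont: "continuous_on UNIV f"
    and B: "\<And>n. norm (fourier_coeff P f (int (Suc n))) \<le> B n" and sumB: "summable B"
  shows "(\<lambda>n. fourier_term P f (Suc n) t) sums (f t - Re (fourier_coeff P f 0))"
proof -
  let ?A = "\<lambda>n. fourier_term P f (Suc n)" and ?I = "{- (P / 2)..P / 2}"
  let ?S = "\<lambda>N t. \<Sum>n<N. ?A n t"
  define L where "L t = (\<Sum>n. ?A n t)" for t
  have bound: "\<bar>?A n t\<bar> \<le> 2 * B n" for n t
    using abs_fourier_term_le[of P f "Suc n" t] B[of n] by linarith
  have summ: "summable (\<lambda>n. ?A n t)" for t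
    by (rule summable_comparison_test'[OF summable_mult[OF sumB, of 2], of 0])
       (simp only: real_norm_def bound)
  have lim: "uniform_limit UNIV ?S L sequentially"
    unfolding L_def
    by (rule Weierstrass_m_test[OF _ summable_mult[OF sumB, of 2]]) (simp only: real_norm_def bound)
  have contA: "continuous_on S (fourier_term P f n)" for S n
    unfolding fourier_term_def[abs_def] by (intro continuous_intros)
  have contL: "continuous_on UNIV L"
    by (rule uniform_limit_theorem[OF _ lim])
       (simp_all add: continuous_on_sum contA)
  define c0 where "c0 = Re (fourier_coeff P f 0)"
  have c0: "fourier_coeff P f 0 = of_real c0"
    using cnj_fourier_coeff[of P f 0] by (simp add: c0_def complex_eq_iff)
  define g where "g t = f t - c0 - L t" for t
  have contg: "continuous_on UNIV g" unfolding g_def by (intro continuous_intros cont contL)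
  have perg: "g (t + P) = g t" for t
    using P by (simp add: g_def per L_def fourier_term_def wave_add)
  have null: "integral ?I (\<lambda>t. of_real (g t) * wave P k t) = 0" for k
  proof -
    let ?h = "\<lambda>N t. complex_of_real (f t - c0 - ?S N t) * wave P k t"
    have conth: "continuous_on ?I (?h N)" for N
      by (intro continuous_intros contA continuous_on_subset[OF cont]) auto
    have "uniform_limit ?I ?h (\<lambda>t. of_real (g t) * wave P k t) sequentially"
    proof (rule uniform_limitI)
      fix e :: real assume "e > 0"
      from uniform_limitD[OF lim this]
      show "\<forall>\<^sub>F N in sequentially. \<forall>t\<in>?I. dist (?h N t) (of_real (g t) * wave P k t) < e"
      proof eventually_elim
        case (elim N)
        have "dist (?h N t) (of_real (g t) * wave P k t) = dist (?S N t) (L t)" for t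
        proof -
          have "?h N t - of_real (g t) * wave P k t = of_real (L t - ?S N t) * wave P k t"
            by (simp add: g_def algebra_simps)
          then show ?thesis
            by (simp only: dist_norm norm_mult norm_wave norm_of_real) (simp add: abs_minus_commute)
        qed
        with elim show ?case by simp
      qed
    qed
    from uniform_limit_integral[OF this conth] obtain I J where IJ:
      "\<And>N. (?h N has_integral I N) ?I" "((\<lambda>t. of_real (g t) * wave P k t) has_integral J) ?I"
      "I \<longlonglongrightarrow> J" by auto
    \<comment> \<open>Testing against \<open>wave P k\<close> extracts the coefficient of frequency
      \<open>- k\<close>; once \<open>N\<close> reaches \<open>\<bar>k\<bar>\<close>, the constant
      term and the partial sum together contain that frequency and cancel it exactly.\<close>
    have "I N = 0" if N: "nat \<bar>k\<bar> \<le> N" for N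
    proof -
      let ?c = "fourier_coeff P f"
      have 1: "((\<lambda>t. complex_of_real (f t) * wave P k t) has_integral of_real P * ?c (- k)) ?I"
        using P by (simp add: fourier_coeff_def)
          (intro integrable_integral integrable_continuous_real continuous_intros continuous_on_subset[OF cont], auto)
      have 2: "((\<lambda>t. complex_of_real c0 * wave P k t) has_integral
          complex_of_real c0 * (if k = 0 then of_real P else 0)) ?I"
        by (subst integral_wave[OF P, symmetric]) (intro has_integral_mult_right
            integrable_integral integrable_continuous_real continuous_on_wave)
      have 3: "((\<lambda>t. \<Sum>n<N. complex_of_real (?A n t) * wave P k t) has_integral
          (\<Sum>n<N. of_real P * ((if int (Suc n) + k = 0 then ?c (int (Suc n)) else 0) +
            (if k = int (Suc n) then ?c (- int (Suc n)) else 0)))) ?I"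
        by (intro has_integral_sum fourier_term_has_integral[OF P]) auto
      have "(\<Sum>n<N. of_real P * ((if int (Suc n) + k = 0 then ?c (int (Suc n)) else 0) +
            (if k = int (Suc n) then ?c (- int (Suc n)) else 0))) =
          (if k = 0 then 0 else of_real P * ?c (- k))"
      proof -
        \<comment> \<open>Only the summand with \<open>Suc n = \<bar>k\<bar>\<close> can be
          nonzero.\<close>
        consider "k = 0" | m where "k = int (Suc m)" "m < N" | m where "k = - int (Suc m)" "m < N"
        proof -
          consider "k = 0" | "k > 0" | "k < 0" by linarith
          then show ?thesis
          proof cases
            case 2 then show ?thesis using that(2)[of "nat (k - 1)"] N by auto
          next
            case 3 then show ?thesis using that(3)[of "nat (- k - 1)"] N by auto
          qed (use that in auto)
        qed
        then show ?thesis
        proof cases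
          case (2 m)
          then have "(\<Sum>n<N. of_real P * ((if int (Suc n) + k = 0 then ?c (int (Suc n)) else 0) +
            (if k = int (Suc n) then ?c (- int (Suc n)) else 0))) = (\<Sum>n<N. if n = m then of_real P * ?c (- k) else 0)"
            by (intro sum.cong) auto
          with 2 show ?thesis by simp
        next
          case (3 m)
          then have "(\<Sum>n<N. of_real P * ((if int (Suc n) + k = 0 then ?c (int (Suc n)) else 0) +
            (if k = int (Suc n) then ?c (- int (Suc n)) else 0))) = (\<Sum>n<N. if n = m then of_real P * ?c (- k) else 0)"
            by (intro sum.cong) (auto simp: add.commute)
          with 3 show ?thesis by simp
        qed auto
      qed
      with has_integral_diff[OF has_integral_diff[OF 1 2] 3]
      have "(?h N has_integral of_real P * ?c (- k) - complex_of_real c0 * (if k = 0 then of_real P else 0)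
         - (if k = 0 then 0 else of_real P * ?c (- k))) ?I"
        by (simp add: left_diff_distrib sum_distrib_right)
      then have "(?h N has_integral 0) ?I" by (cases "k = 0") (simp_all add: c0)
      with IJ(1)[of N] show ?thesis by (rule has_integral_unique)
    qed
    then have "eventually (\<lambda>N. I N = 0) sequentially"
      by (auto simp: eventually_sequentially)
    then have "I \<longlonglongrightarrow> 0" by (rule tendsto_eventually)
    with IJ(3) have "J = 0" by (rule LIMSEQ_unique)
    with IJ(2) show ?thesis by (simp add: integral_unique)
  qed
  have "fourier_null P (\<lambda>t. of_real (g t))"
    using null by (auto simp: fourier_null_def intro!: continuous_intros continuous_on_subset[OF contg])
  from fourier_null_eq_0[of P g, OF P perg contg this]
  have "L t = f t - c0" by (simp add: g_def)
  then show ?thesis using summable_sums[OF summ[of t]] by (simp add: L_def c0_def)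
qed

section \<open>Tail sums and the truncation error\<close>

text \<open>The right-hand side is the integral of \<open>1 / t ^ Suc q\<close> over
  \<open>{x..x + 1}\<close>; Bernoulli's inequality for \<open>(1 + 1 / x) ^ q\<close> replaces the
  integral comparison.\<close>

lemma inverse_power_telescope:
  assumes "q \<ge> 1" "x > (0::real)"
  shows "1 / (x + 1) ^ Suc q \<le> (1 / x ^ q - 1 / (x + 1) ^ q) / real q"
proof -
  have "1 + real q * (1 / x) \<le> (1 + 1 / x) ^ q"
    using assms by (intro Bernoulli_inequality) (auto simp: field_simps)
  also have "(1 + 1 / x) ^ q = (x + 1) ^ q / x ^ q"
    using assms by (simp add: add_divide_distrib flip: power_divide)
  finally have *: "real q / x \<le> (x + 1) ^ q / x ^ q - 1" by simp
  have "real q / (x + 1) \<le> real q / x" using assms by (intro divide_left_mono) auto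
  with * have "real q / (x + 1) \<le> (x + 1) ^ q / x ^ q - 1" by linarith
  then have "real q / (x + 1) / (x + 1) ^ q \<le> ((x + 1) ^ q / x ^ q - 1) / (x + 1) ^ q"
    using assms by (intro divide_right_mono) auto
  also have "\<dots> = 1 / x ^ q - 1 / (x + 1) ^ q"
    using assms by (simp add: diff_divide_distrib)
  finally show ?thesis using assms by (simp add: field_simps)
qed

lemma inverse_power_tail:
  assumes "q \<ge> 1" "M > 0"
  shows "summable (\<lambda>n. 1 / real (Suc (n + M)) ^ Suc q)"
    and "(\<Sum>n. 1 / real (Suc (n + M)) ^ Suc q) \<le> 1 / (real q * real M ^ q)"
proof -
  let ?b = "\<lambda>n. 1 / real (n + M) ^ q / real q"
  have le: "1 / real (Suc (n + M)) ^ Suc q \<le> ?b n - ?b (Suc n)" for n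
    using inverse_power_telescope[of q "real (n + M)"] assms
    by (simp add: diff_divide_distrib add_ac)
  have "(\<lambda>n. 1 / real (n + M)) \<longlonglongrightarrow> 0"
    by (rule real_tendsto_divide_at_top[OF tendsto_const])
       (rule filterlim_compose[OF filterlim_real_sequentially filterlim_add_const_nat_at_top])
  from tendsto_power[OF this, of q] have "(\<lambda>n. 1 / real (n + M) ^ q) \<longlonglongrightarrow> 0"
    using assms by (simp add: power_divide zero_power)
  from tendsto_divide[OF this tendsto_const, of "real q"] have "?b \<longlonglongrightarrow> 0" using assms by simp
  from telescope_sums'[OF this] have s: "(\<lambda>n. ?b n - ?b (Suc n)) sums (1 / (real q * real M ^ q))"
    by (simp add: mult.commute)
  show *: "summable (\<lambda>n. 1 / real (Suc (n + M)) ^ Suc q)"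
    by (rule summable_comparison_test'[OF sums_summable[OF s], of 0]) (use le in auto)
  show "(\<Sum>n. 1 / real (Suc (n + M)) ^ Suc q) \<le> 1 / (real q * real M ^ q)"
    using sums_unique[OF s] suminf_le[OF le * sums_summable[OF s]] by simp
qed

theorem fourier_truncation_error:
  fixes f :: "real \<Rightarrow> real"
  assumes P: "P > 0" and per: "\<And>t. f (t + P) = f t" and q: "q \<ge> 1"
    and diff: "\<And>j x. j < q - 1 \<Longrightarrow> (deriv ^^ j) f differentiable (at x)"
    and cont: "\<And>j. j < q \<Longrightarrow> continuous_on UNIV ((deriv ^^ j) f)"
    and var: "qth_derivative_variation_le q P f V" and M: "M > 0"
  shows "\<bar>f t - (Re (fourier_coeff P f 0) + (\<Sum>n<M. fourier_term P f (Suc n) t))\<bar>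
    \<le> V / (pi * real q) * (P / (2 * pi * real M)) ^ q"
proof -
  let ?A = "\<lambda>n. fourier_term P f (Suc n) t"
  define C where "C = V / pi * (P / (2 * pi)) ^ q"
  \<comment> \<open>The half is made up for by \<open>fourier_term\<close>, which pairs two
    frequencies, so the terms themselves are bounded with \<open>C\<close>.\<close>
  let ?B = "\<lambda>n. C / 2 * (1 / real (Suc n) ^ Suc q)"
  have decay: "norm (fourier_coeff P f (int (Suc n))) \<le> ?B n" for n
    using norm_fourier_coeff_decay[of P f q V "int (Suc n)", OF P per q diff cont var] q
    by (simp add: C_def power_divide power_mult_distrib mult_ac del: of_nat_Suc)
  have "summable (\<lambda>n. 1 / real (Suc n) ^ Suc q)"
    using inverse_power_tail(1)[OF q, of 1] summable_Suc_iff[of "\<lambda>n. 1 / real (Suc n) ^ Suc q"]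
    by (simp del: of_nat_Suc power_Suc)
  then have sumB: "summable ?B" by (rule summable_mult)
  have f: "continuous_on UNIV f" using cont[of 0] q by simp
  have s: "?A sums (f t - Re (fourier_coeff P f 0))"
    by (rule fourier_series_sums[of P f, OF P per f decay sumB])
  have bound: "norm (?A n) \<le> C * (1 / real (Suc n) ^ Suc q)" for n
    using abs_fourier_term_le[of P f "Suc n" t] decay[of n] by (simp del: of_nat_Suc power_Suc)
  have tail: "summable (\<lambda>n. C * (1 / real (Suc (n + M)) ^ Suc q))"
    by (intro summable_mult inverse_power_tail(1) q M)
  \<comment> \<open>The sign of \<open>V\<close> is not assumed; that of \<open>C\<close> is read
    off from a bound on a norm.\<close>
  have "C * (1 / real (Suc 0) ^ Suc q) \<ge> 0" using bound[of 0] norm_ge_zero order_trans by blast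
  then have C: "C \<ge> 0" by simp
  have "f t - (Re (fourier_coeff P f 0) + (\<Sum>n<M. ?A n)) = (\<Sum>n. ?A (n + M))"
    using suminf_minus_initial_segment[OF sums_summable[OF s], of M] sums_unique[OF s] by simp
  also have "norm \<dots> \<le> (\<Sum>n. C * (1 / real (Suc (n + M)) ^ Suc q))"
    by (rule norm_suminf_le[OF _ tail]) (rule bound)
  also have "\<dots> = C * (\<Sum>n. 1 / real (Suc (n + M)) ^ Suc q)"
    by (intro suminf_mult inverse_power_tail(1) q M)
  also have "\<dots> \<le> C * (1 / (real q * real M ^ q))"
    by (intro mult_left_mono inverse_power_tail(2) q M C)
  also have "\<dots> = V / (pi * real q) * (P / (2 * pi * real M)) ^ q"
    by (simp add: C_def power_divide power_mult_distrib)
  finally show ?thesis by simp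
qed

section \<open>Separable expansions\<close>

text \<open>Stars and bars: the slack \<open>m - sum \<alpha> UNIV\<close>, put in front, turns a
  multi-index into a list of length \<open>Suc CARD('d)\<close> with sum exactly
  \<open>m\<close>.\<close>

lemma multi_indices:
  fixes m :: nat
  shows finite_multi_indices: "finite {\<alpha>::'d::finite \<Rightarrow> nat. sum \<alpha> UNIV \<le> m}"
    and card_multi_indices_le:
      "card {\<alpha>::'d::finite \<Rightarrow> nat. sum \<alpha> UNIV \<le> m} \<le> (m + CARD('d)) choose CARD('d)"
proof -
  let ?S = "{\<alpha>::'d \<Rightarrow> nat. sum \<alpha> UNIV \<le> m}"
  let ?L = "{l::nat list. size l = Suc CARD('d) \<and> sum_list l = m}"
  obtain xs :: "'d list" where xs: "set xs = UNIV" "distinct xs"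
    using finite_distinct_list[of "UNIV :: 'd set"] by auto
  have len: "length xs = CARD('d)" using distinct_card[OF xs(2)] xs(1) by simp
  let ?f = "\<lambda>\<alpha>. (m - sum \<alpha> UNIV) # map \<alpha> xs"
  have inj: "inj_on ?f ?S"
    using xs(1) by (auto simp: inj_on_def map_eq_conv fun_eq_iff)
  have img: "?f ` ?S \<subseteq> ?L"
    using xs by (auto simp: len sum_list_distinct_conv_sum_set)
  have card: "card ?L = (m + CARD('d)) choose CARD('d)"
    using card_length_sum_list[of "Suc CARD('d)" m] binomial_symmetric[of m "m + CARD('d)"] by simp
  \<comment> \<open>Infinite sets have cardinality 0, so a positive count also proves
    finiteness.\<close>
  then have "card ?L > 0" by simp
  then have fin: "finite ?L" by (rule card_ge_0_finite)
  show "finite ?S" by (rule inj_on_finite[OF inj img fin])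
  show "card ?S \<le> (m + CARD('d)) choose CARD('d)"
    using card_inj_on_le[OF inj img fin] card by simp
qed

text \<open>The rank count only uses that the coefficients do not depend on \<open>w\<close>, so the
  multinomial coefficients are never computed.\<close>

lemma multinomial_expansion:
  "\<exists>C. \<forall>w::'d::finite \<Rightarrow> real.
     (\<Sum>i\<in>UNIV. w i) ^ j = (\<Sum>\<alpha> | sum \<alpha> UNIV = j. C \<alpha> * (\<Prod>i\<in>UNIV. w i ^ \<alpha> i))"
proof (induction j)
  case 0
  have "{\<alpha>::'d \<Rightarrow> nat. sum \<alpha> UNIV = 0} = {\<lambda>_. 0}" by (auto simp: fun_eq_iff)
  then show ?case by (intro exI[of _ "\<lambda>_. 1"]) simp
next
  case (Suc j)
  then obtain C where C: "(\<Sum>i\<in>UNIV. w i) ^ j =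
      (\<Sum>\<alpha> | sum \<alpha> UNIV = j. C \<alpha> * (\<Prod>i\<in>UNIV. w i ^ \<alpha> i))" for w :: "'d \<Rightarrow> real"
    by blast
  define A where "A j = {\<alpha>::'d \<Rightarrow> nat. sum \<alpha> UNIV = j}" for j
  have finA: "finite (A j)" for j
    by (rule finite_subset[OF _ finite_multi_indices[of j]]) (auto simp: A_def)
  define h where "h p = (fst p)(snd p := Suc (fst p (snd p)))" for p :: "('d \<Rightarrow> nat) \<times> 'd"
  let ?T = "A j \<times> (UNIV :: 'd set)"
  have "sum (h (\<alpha>, i)) UNIV = Suc (sum \<alpha> UNIV)" for \<alpha> i
  proof -
    have "sum (h (\<alpha>, i)) UNIV = h (\<alpha>, i) i + sum (h (\<alpha>, i)) (UNIV - {i})"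
      by (rule sum.remove) auto
    also have "sum (h (\<alpha>, i)) (UNIV - {i}) = sum \<alpha> (UNIV - {i})"
      by (rule sum.cong) (auto simp: h_def)
    also have "h (\<alpha>, i) i + \<dots> = Suc (\<alpha> i + sum \<alpha> (UNIV - {i}))" by (simp add: h_def)
    also have "\<alpha> i + sum \<alpha> (UNIV - {i}) = sum \<alpha> UNIV" by (rule sum.remove[symmetric]) auto
    finally show ?thesis .
  qed
  then have hT: "h ` ?T \<subseteq> A (Suc j)" by (auto simp: A_def)
  have prod: "(\<Prod>k\<in>UNIV. w k ^ h (\<alpha>, i) k) = w i * (\<Prod>k\<in>UNIV. w k ^ \<alpha> k)"
    for \<alpha> i and w :: "'d \<Rightarrow> real"
  proof -
    have "(\<Prod>k\<in>UNIV. w k ^ h (\<alpha>, i) k) = w i ^ h (\<alpha>, i) i * (\<Prod>k\<in>UNIV - {i}. w k ^ h (\<alpha>, i) k)"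
      by (rule prod.remove) auto
    also have "(\<Prod>k\<in>UNIV - {i}. w k ^ h (\<alpha>, i) k) = (\<Prod>k\<in>UNIV - {i}. w k ^ \<alpha> k)"
      by (rule prod.cong) (auto simp: h_def)
    also have "w i ^ h (\<alpha>, i) i * \<dots> = w i * (w i ^ \<alpha> i * (\<Prod>k\<in>UNIV - {i}. w k ^ \<alpha> k))"
      by (simp add: h_def)
    also have "w i ^ \<alpha> i * (\<Prod>k\<in>UNIV - {i}. w k ^ \<alpha> k) = (\<Prod>k\<in>UNIV. w k ^ \<alpha> k)"
      by (rule prod.remove[symmetric]) auto
    finally show ?thesis .
  qed
  \<comment> \<open>Multiplying a monomial by \<open>w i\<close> raises one exponent, which is the
    map \<open>h\<close>. Several pairs can reach the same \<open>\<beta>\<close>, so its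
    coefficient is a sum over the fibre of \<open>h\<close>.\<close>
  have "(\<Sum>i\<in>UNIV. w i) ^ Suc j = (\<Sum>\<beta>\<in>A (Suc j). (\<Sum>p | p \<in> ?T \<and> h p = \<beta>. C (fst p)) *
      (\<Prod>k\<in>UNIV. w k ^ \<beta> k))" for w :: "'d \<Rightarrow> real"
  proof -
    have "(\<Sum>i\<in>UNIV. w i) ^ Suc j = (\<Sum>\<alpha>\<in>A j. \<Sum>i\<in>UNIV. C \<alpha> * (w i * (\<Prod>k\<in>UNIV. w k ^ \<alpha> k)))"
      by (simp add: C A_def sum_distrib_left sum_distrib_right mult_ac)
    also have "\<dots> = (\<Sum>p\<in>?T. C (fst p) * (\<Prod>k\<in>UNIV. w k ^ h p k))"
      by (simp add: sum.cartesian_product case_prod_unfold flip: prod)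
    also have "\<dots> = (\<Sum>\<beta>\<in>A (Suc j). \<Sum>p | p \<in> ?T \<and> h p = \<beta>. C (fst p) * (\<Prod>k\<in>UNIV. w k ^ h p k))"
      by (rule sum.group[symmetric]) (use finA hT in auto)
    also have "\<dots> = (\<Sum>\<beta>\<in>A (Suc j). (\<Sum>p | p \<in> ?T \<and> h p = \<beta>. C (fst p)) * (\<Prod>k\<in>UNIV. w k ^ \<beta> k))"
      by (intro sum.cong refl) (auto simp: sum_distrib_right intro!: sum.cong)
    finally show ?thesis .
  qed
  then show ?case by (intro exI) (auto simp: A_def)
qed

text \<open>Each multi-index occurs in exactly one power of \<open>u \<bullet> v\<close>, that of
  its degree, so all powers up to \<open>m\<close> together need one product per
  multi-index.\<close>

lemma inner_polynomial_expansion: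
  fixes b :: "nat \<Rightarrow> complex"
  obtains c :: "('d::finite \<Rightarrow> nat) \<Rightarrow> complex"
  where "\<And>u v :: real ^ 'd. (\<Sum>j\<le>m. b j * of_real (u \<bullet> v) ^ j) =
    (\<Sum>\<alpha> | sum \<alpha> UNIV \<le> m. c \<alpha> * of_real (\<Prod>i\<in>UNIV. u $ i ^ \<alpha> i) * of_real (\<Prod>i\<in>UNIV. v $ i ^ \<alpha> i))"
proof -
  have "\<forall>j. \<exists>C. \<forall>w::'d \<Rightarrow> real. (\<Sum>i\<in>UNIV. w i) ^ j =
      (\<Sum>\<alpha> | sum \<alpha> UNIV = j. C \<alpha> * (\<Prod>i\<in>UNIV. w i ^ \<alpha> i))"
    by (intro allI multinomial_expansion)
  from choice[OF this] obtain C where C: "\<And>j (w::'d \<Rightarrow> real). (\<Sum>i\<in>UNIV. w i) ^ j =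
      (\<Sum>\<alpha> | sum \<alpha> UNIV = j. C j \<alpha> * (\<Prod>i\<in>UNIV. w i ^ \<alpha> i))"
    by auto
  let ?S = "{\<alpha>::'d \<Rightarrow> nat. sum \<alpha> UNIV \<le> m}"
  have "(\<Sum>j\<le>m. b j * of_real (u \<bullet> v) ^ j) =
      (\<Sum>\<alpha>\<in>?S. b (sum \<alpha> UNIV) * of_real (C (sum \<alpha> UNIV) \<alpha>) *
        of_real (\<Prod>i\<in>UNIV. u $ i ^ \<alpha> i) * of_real (\<Prod>i\<in>UNIV. v $ i ^ \<alpha> i))" for u v :: "real ^ 'd"
  proof -
    let ?t = "\<lambda>j \<alpha>. b j * complex_of_real (C j \<alpha> * (\<Prod>i\<in>UNIV. (u $ i * v $ i) ^ \<alpha> i))"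
    have "b j * of_real (u \<bullet> v) ^ j = (\<Sum>\<alpha> | \<alpha> \<in> ?S \<and> sum \<alpha> UNIV = j. ?t (sum \<alpha> UNIV) \<alpha>)"
      if "j \<le> m" for j
    proof -
      have "u \<bullet> v = (\<Sum>i\<in>UNIV. u $ i * v $ i)" by (simp add: inner_vec_def)
      then have "(u \<bullet> v) ^ j =
          (\<Sum>\<alpha> | sum \<alpha> UNIV = j. C j \<alpha> * (\<Prod>i\<in>UNIV. (u $ i * v $ i) ^ \<alpha> i))"
        by (simp only: C)
      then have "b j * of_real ((u \<bullet> v) ^ j) = (\<Sum>\<alpha> | sum \<alpha> UNIV = j. ?t j \<alpha>)"
        by (simp only: of_real_sum sum_distrib_left)
      then have "b j * of_real (u \<bullet> v) ^ j = (\<Sum>\<alpha> | sum \<alpha> UNIV = j. ?t j \<alpha>)"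
        by (simp only: of_real_power)
      also have "\<dots> = (\<Sum>\<alpha> | \<alpha> \<in> ?S \<and> sum \<alpha> UNIV = j. ?t (sum \<alpha> UNIV) \<alpha>)"
        using that by (intro sum.cong) auto
      finally show ?thesis .
    qed
    then have "(\<Sum>j\<le>m. b j * of_real (u \<bullet> v) ^ j) =
        (\<Sum>j\<le>m. \<Sum>\<alpha> | \<alpha> \<in> ?S \<and> sum \<alpha> UNIV = j. ?t (sum \<alpha> UNIV) \<alpha>)"
      by (intro sum.cong) auto
    also have "\<dots> = (\<Sum>\<alpha>\<in>?S. ?t (sum \<alpha> UNIV) \<alpha>)"
      by (rule sum.group) (auto simp: finite_multi_indices)
    also have "\<dots> = (\<Sum>\<alpha>\<in>?S. b (sum \<alpha> UNIV) * of_real (C (sum \<alpha> UNIV) \<alpha>) *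
        of_real (\<Prod>i\<in>UNIV. u $ i ^ \<alpha> i) * of_real (\<Prod>i\<in>UNIV. v $ i ^ \<alpha> i))"
      by (intro sum.cong refl)
        (simp only: power_mult_distrib prod.distrib of_real_mult mult.assoc)
    finally show ?thesis .
  qed
  then show ?thesis by (rule that)
qed

section \<open>Calculus of finite-rank functions\<close>

text \<open>Summands may vanish, so this says that \<open>F\<close> has rank at most
  \<open>R\<close>.\<close>

definition separable :: "nat \<Rightarrow> ('a \<Rightarrow> 'b \<Rightarrow> real) \<Rightarrow> bool" where
  "separable R F \<longleftrightarrow>
     (\<exists>(g :: nat \<Rightarrow> 'a \<Rightarrow> real) (h :: nat \<Rightarrow> 'b \<Rightarrow> real). \<forall>x y. F x y = (\<Sum>i=1..R. g i x * h i y))"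

lemma separable_sum_mult:
  assumes "finite I"
  shows "separable (card I) (\<lambda>x y. \<Sum>i\<in>I. g i x * h i y)"
proof -
  obtain e where e: "bij_betw e {1..card I} I"
    using ex_bij_betw_nat_finite_1[OF assms] by blast
  have "(\<Sum>i\<in>I. g i x * h i y) = (\<Sum>k=1..card I. g (e k) x * h (e k) y)" for x y
    by (rule sum.reindex_bij_betw[OF e, symmetric])
  then show ?thesis unfolding separable_def
    by (intro exI[of _ "\<lambda>k. g (e k)"] exI[of _ "\<lambda>k. h (e k)"]) simp
qed

lemma separable_const: "separable 1 (\<lambda>x y. c)"
  using separable_sum_mult[of "{()}" "\<lambda>_ _. c" "\<lambda>_ _. 1"] by simp

lemma separable_add:
  assumes "separable R F" "separable S G"
  shows "separable (R + S) (\<lambda>x y. F x y + G x y)"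
proof -
  obtain g h where F: "\<And>x y. F x y = (\<Sum>i=1..R. g i x * h i y)"
    using assms(1) unfolding separable_def by blast
  obtain g' h' where G: "\<And>x y. G x y = (\<Sum>i=1..S. g' i x * h' i y)"
    using assms(2) unfolding separable_def by blast
  let ?I = "{1..R} <+> {1..S}"
  have "separable (card ?I) (\<lambda>x y. \<Sum>i\<in>?I. case_sum g g' i x * case_sum h h' i y)"
    by (rule separable_sum_mult) simp
  then show ?thesis by (simp add: card_Plus sum.Plus F G)
qed

lemma separable_sum:
  assumes "\<And>n. n < M \<Longrightarrow> separable R (F n)"
  shows "separable (M * R) (\<lambda>x y. \<Sum>n<M. F n x y)"
  using assms
proof (induction M)
  case 0
  show ?case by (simp add: separable_def)
next
  case (Suc M)
  then show ?case using separable_add[of "M * R" "\<lambda>x y. \<Sum>n<M. F n x y" R "F M"]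
    by (simp add: add.commute)
qed

text \<open>\<open>Re (z * w) = Re z * Re w - Im z * Im w\<close>: each complex product costs two
  real ones.\<close>

lemma separable_Re_sum_mult:
  fixes z :: "'i \<Rightarrow> 'a \<Rightarrow> complex" and w :: "'i \<Rightarrow> 'b \<Rightarrow> complex"
  assumes "finite I"
  shows "separable (card I + card I) (\<lambda>x y. 2 * Re (\<Sum>i\<in>I. z i x * w i y))"
proof -
  have "separable (card I + card I) (\<lambda>x y. (\<Sum>i\<in>I. (2 * Re (z i x)) * Re (w i y)) +
      (\<Sum>i\<in>I. (- 2 * Im (z i x)) * Im (w i y)))"
    by (intro separable_add separable_sum_mult assms)
  moreover have "(\<Sum>i\<in>I. (2 * Re (z i x)) * Re (w i y)) + (\<Sum>i\<in>I. (- 2 * Im (z i x)) * Im (w i y)) =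
      2 * Re (\<Sum>i\<in>I. z i x * w i y)" for x y
    by (simp add: sum_distrib_left sum.distrib[symmetric] algebra_simps)
  ultimately show ?thesis by simp
qed

section \<open>Approximation of the kernel\<close>

text \<open>A single term of the exponential series. At \<open>x = n\<close> it becomes the crude
  Stirling bound \<open>n ^ n / fact n \<le> exp n\<close>.\<close>

lemma power_le_exp_mult_fact:
  assumes "x \<ge> (0::real)"
  shows "x ^ n / fact n \<le> exp x"
proof -
  have s: "(\<lambda>n. x ^ n / fact n) sums exp x"
    using exp_converges[of x] by (simp add: divide_inverse mult.commute)
  have "(\<Sum>k\<in>{n}. x ^ k / fact k) \<le> (\<Sum>k. x ^ k / fact k)"
    using assms by (intro sum_le_suminf sums_summable[OF s]) auto
  then show ?thesis using sums_unique[OF s] by simp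
qed

text \<open>By the Stirling bound \<open>(pi * M) ^ m / fact m\<close> is at most
  \<open>(pi * exp 1 / 9) ^ m\<close>. Since \<open>pi * exp 1 < 9\<close>, this decays
  geometrically in \<open>m\<close>, fast enough to absorb the factor \<open>M\<close>.\<close>

lemma taylor_remainder_constant_le:
  assumes "M > 0" "9 * M \<le> m"
  shows "2 * real M * ((pi * real M) ^ Suc m / fact (Suc m)) \<le> 1"
proof -
  have m: "m > 0" using assms by simp
  have pi: "pi \<le> 315 / 100" using pi_approx(2) by simp
  have e: "exp 1 \<le> (272 / 100 :: real)" using abs_le_D1[OF e_approx_32] by simp
  have "pi * exp 1 \<le> 315 / 100 * (272 / 100)" using pi e by (intro mult_mono) auto
  \<comment> \<open>\<open>119 / 125\<close> is the product \<open>315 / 100 * (272 / 100)\<close>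
    divided by 9; its ninth power is below \<open>2 / 3\<close>.\<close>
  then have pe: "pi / 9 * exp 1 \<le> 119 / 125" by simp
  have 1: "pi * real M / real m \<le> pi / 9"
    using assms m by (simp add: field_simps)
  have "(pi * real M) ^ m / fact m = (pi * real M / real m) ^ m * (real m ^ m / fact m)"
    using m by (simp add: power_divide)
  also have "\<dots> \<le> (pi / 9) ^ m * exp (real m)"
    using 1 m by (intro mult_mono power_mono power_le_exp_mult_fact) auto
  also have "\<dots> = (pi / 9 * exp 1) ^ m"
    using exp_of_nat_mult[of m "1::real"] by (simp add: power_mult_distrib power_divide)
  also have "\<dots> \<le> (119 / 125) ^ m" using pe by (intro power_mono) auto
  also have "\<dots> \<le> (119 / 125) ^ (9 * M)" using assms by (intro power_decreasing) auto
  also have "\<dots> = ((119 / 125) ^ 9) ^ M" by (rule power_mult)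
  also have "\<dots> \<le> (2 / 3) ^ M" by (intro power_mono) (simp_all add: field_simps)
  finally have 2: "(pi * real M) ^ m / fact m \<le> (2 / 3) ^ M" .
  have "pi * real M / real (Suc m) \<le> pi * real M / real m"
    using m by (intro divide_left_mono) auto
  with 1 pi have 3: "pi * real M / real (Suc m) \<le> 35 / 100" by linarith
  \<comment> \<open>From 2 on, the ratio of consecutive integers is at most \<open>3 / 2\<close>;
    the smaller cases are checked by hand.\<close>
  have "real n \<le> (3 / 2) ^ n" for n
  proof (induction n)
    case (Suc n)
    consider "n = 0" | "n = 1" | "n \<ge> 2" by linarith
    then show ?case
    proof cases
      case 3
      then have "real (Suc n) \<le> 3 / 2 * real n" by simp
      with Suc show ?thesis by simp
    qed auto
  qed simp
  from this[of M] have 4: "real M * (2 / 3) ^ M \<le> 1"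
    by (simp add: power_divide field_simps)
  have "(pi * real M) ^ Suc m / fact (Suc m) = pi * real M / real (Suc m) * ((pi * real M) ^ m / fact m)"
    by (simp add: field_simps)
  also have "\<dots> \<le> 35 / 100 * (2 / 3) ^ M"
    using 2 3 by (intro mult_mono) auto
  finally have "2 * real M * ((pi * real M) ^ Suc m / fact (Suc m)) \<le> 2 * real M * (35 / 100 * (2 / 3) ^ M)"
    by (intro mult_left_mono) auto
  also have "\<dots> = 70 / 100 * (real M * (2 / 3) ^ M)" by simp
  also have "\<dots> \<le> 1" using 4 by simp
  finally show ?thesis .
qed

section \<open>The periodic extension and the kernel on the domain\<close>

lemma periodic_extension_periodic:
  "periodic_extension D T f (x + 4 * D\<^sup>2) = periodic_extension D T f x"
proof -
  have "bij_betw (\<lambda>n::int. n + 1) UNIV UNIV"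
    by (rule bij_betw_byWitness[of _ "\<lambda>n. n - 1"]) auto
  from infsum_reindex_bij_betw[OF this,
    of "\<lambda>n. T (x + 4 * of_int n * D\<^sup>2) * f (x + 4 * of_int n * D\<^sup>2)"]
  show ?thesis by (simp add: periodic_extension_def algebra_simps)
qed

lemma periodic_extension_eq:
  assumes "window D T" "\<bar>x\<bar> \<le> D\<^sup>2"
  shows "periodic_extension D T f x = f x"
proof -
  have "T (x + 4 * of_int n * D\<^sup>2) = 0" if "n \<noteq> 0" for n
  proof -
    have "\<bar>of_int n\<bar> \<ge> (1::real)" using that by linarith
    then have "1 * D\<^sup>2 \<le> \<bar>of_int n\<bar> * D\<^sup>2" by (intro mult_right_mono) auto
    \<comment> \<open>With \<open>\<bar>x\<bar> \<le> D^2\<close> the shifted argument keeps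
      absolute value at least \<open>3 * D^2\<close>, where the window is 0.\<close>
    then have "\<bar>4 * of_int n * D\<^sup>2\<bar> \<ge> 4 * D\<^sup>2" by (simp add: abs_mult)
    with assms show ?thesis by (auto simp: window_def)
  qed
  then have "(\<Sum>\<^sub>\<infinity>n::int. T (x + 4 * of_int n * D\<^sup>2) * f (x + 4 * of_int n * D\<^sup>2)) =
      (\<Sum>\<^sub>\<infinity>n\<in>{0::int}. T (x + 4 * of_int n * D\<^sup>2) * f (x + 4 * of_int n * D\<^sup>2))"
    by (intro infsum_cong_neutral) auto
  then show ?thesis using assms by (simp add: periodic_extension_def window_def)
qed

lemma norm_diff_box_le:
  fixes x y :: "real ^ 'd"
  assumes "\<forall>i. x $ i \<in> {0..D / sqrt (real CARD('d))}" "\<forall>i. y $ i \<in> {0..D / sqrt (real CARD('d))}"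
  shows "(norm (x - y))\<^sup>2 \<le> D\<^sup>2"
proof -
  have "(norm (x - y))\<^sup>2 = (\<Sum>i\<in>UNIV. (x $ i - y $ i)\<^sup>2)"
    by (simp add: norm_vec_def L2_set_def sum_nonneg)
  also have "\<dots> \<le> (\<Sum>i\<in>(UNIV::'d set). (D / sqrt (real CARD('d)))\<^sup>2)"
  proof (rule sum_mono)
    fix i
    have "\<bar>x $ i - y $ i\<bar> \<le> D / sqrt (real CARD('d))"
      using assms[THEN spec[of _ i]] by (auto simp: abs_le_iff)
    then show "(x $ i - y $ i)\<^sup>2 \<le> (D / sqrt (real CARD('d)))\<^sup>2"
      by (metis abs_ge_zero power2_abs power_mono)
  qed
  also have "\<dots> = D\<^sup>2" by (simp add: power_divide)
  finally show ?thesis .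
qed

lemma fourier_term_separable:
  fixes x\<^sub>0 y\<^sub>0 :: "real ^ 'd"
  assumes P: "P > 0"
  obtains F where "separable (2 * card {\<alpha>::'d \<Rightarrow> nat. sum \<alpha> UNIV \<le> m}) F"
    "\<And>x y. norm (x - x\<^sub>0) \<le> r \<Longrightarrow> norm (y - y\<^sub>0) \<le> s \<Longrightarrow>
       \<bar>fourier_term P f n ((norm (x - y))\<^sup>2) - F x y\<bar>
         \<le> 2 * norm (fourier_coeff P f (int n)) * ((4 * pi * real n / P * (r * s)) ^ Suc m / fact (Suc m))"
proof -
  define \<omega> where "\<omega> = 2 * pi * real n / P"
  define e where "e = x\<^sub>0 - y\<^sub>0"
  \<comment> \<open>Expanding the square of \<open>(x - x\<^sub>0) - (y - y\<^sub>0) + e\<close>,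
    the terms in one variable go into \<open>a\<close> and \<open>b\<close>, the constant into
    \<open>a\<close>; only the product of the two offsets remains coupled.\<close>
  define a where "a x = (norm (x - x\<^sub>0))\<^sup>2 + 2 * ((x - x\<^sub>0) \<bullet> e) + (norm e)\<^sup>2" for x
  define b where "b y = (norm (y - y\<^sub>0))\<^sup>2 - 2 * ((y - y\<^sub>0) \<bullet> e)" for y
  let ?c = "fourier_coeff P f (int n)" and ?S = "{\<alpha>::'d \<Rightarrow> nat. sum \<alpha> UNIV \<le> m}"
  let ?ph = "\<lambda>x y. ?c * cis (\<omega> * a x) * cis (\<omega> * b y)"
  have dist: "(norm (x - y))\<^sup>2 = a x + b y - 2 * ((x - x\<^sub>0) \<bullet> (y - y\<^sub>0))" for x y
    unfolding a_def b_def e_def power2_norm_eq_inner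
    by (simp add: inner_diff_left inner_diff_right inner_commute algebra_simps)
  obtain C :: "('d \<Rightarrow> nat) \<Rightarrow> complex" where
    C: "\<And>u v :: real ^ 'd. (\<Sum>j\<le>m. (\<i> * of_real (- 2 * \<omega>)) ^ j / fact j * of_real (u \<bullet> v) ^ j) =
      (\<Sum>\<alpha>\<in>?S. C \<alpha> * of_real (\<Prod>i\<in>UNIV. u $ i ^ \<alpha> i) * of_real (\<Prod>i\<in>UNIV. v $ i ^ \<alpha> i))"
    using inner_polynomial_expansion[where m = m and b = "\<lambda>j. (\<i> * of_real (- 2 * \<omega>)) ^ j / fact j"] by blast
  define z where "z \<alpha> x = ?c * cis (\<omega> * a x) * C \<alpha> * of_real (\<Prod>i\<in>UNIV. (x - x\<^sub>0) $ i ^ \<alpha> i)" for \<alpha> x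
  define w where "w \<alpha> y = cis (\<omega> * b y) * complex_of_real (\<Prod>i\<in>UNIV. (y - y\<^sub>0) $ i ^ \<alpha> i)" for \<alpha> y
  let ?F = "\<lambda>x y. 2 * Re (\<Sum>\<alpha>\<in>?S. z \<alpha> x * w \<alpha> y)"
  have "separable (2 * card ?S) ?F"
    unfolding mult_2[of "card ?S"] by (rule separable_Re_sum_mult[OF finite_multi_indices])
  moreover have "\<bar>fourier_term P f n ((norm (x - y))\<^sup>2) - ?F x y\<bar>
      \<le> 2 * norm ?c * ((4 * pi * real n / P * (r * s)) ^ Suc m / fact (Suc m))"
    if xy: "norm (x - x\<^sub>0) \<le> r" "norm (y - y\<^sub>0) \<le> s" for x y
  proof -
    define \<theta> where "\<theta> = - 2 * \<omega> * ((x - x\<^sub>0) \<bullet> (y - y\<^sub>0))"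
    let ?T = "\<Sum>j\<le>m. (\<i> * complex_of_real \<theta>) ^ j / fact j"
    have "(\<Sum>\<alpha>\<in>?S. z \<alpha> x * w \<alpha> y) = ?ph x y * (\<Sum>\<alpha>\<in>?S. C \<alpha> *
        of_real (\<Prod>i\<in>UNIV. (x - x\<^sub>0) $ i ^ \<alpha> i) * of_real (\<Prod>i\<in>UNIV. (y - y\<^sub>0) $ i ^ \<alpha> i))"
      unfolding z_def w_def sum_distrib_left by (simp only: mult_ac)
    also have "\<dots> = ?ph x y * (\<Sum>j\<le>m. (\<i> * of_real (- 2 * \<omega>)) ^ j / fact j *
        of_real ((x - x\<^sub>0) \<bullet> (y - y\<^sub>0)) ^ j)"
      by (simp only: C)
    also have "(\<Sum>j\<le>m. (\<i> * of_real (- 2 * \<omega>)) ^ j / fact j * of_real ((x - x\<^sub>0) \<bullet> (y - y\<^sub>0)) ^ j) = ?T"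
      by (simp only: \<theta>_def of_real_mult power_mult_distrib times_divide_eq_left mult.assoc)
    finally have F: "?F x y = 2 * Re (?ph x y * ?T)" by (simp only:)
    have "\<omega> * (norm (x - y))\<^sup>2 = \<omega> * a x + \<omega> * b y + \<theta>"
      unfolding dist \<theta>_def by (simp add: algebra_simps)
    then have "cis (\<omega> * (norm (x - y))\<^sup>2) = cis (\<omega> * a x) * cis (\<omega> * b y) * cis \<theta>"
      by (simp only: cis_mult)
    then have "fourier_term P f n ((norm (x - y))\<^sup>2) = 2 * Re (?ph x y * iexp \<theta>)"
      by (simp only: fourier_term_def wave_def \<omega>_def cis_conv_exp of_int_of_nat_eq mult.assoc)
    then have "fourier_term P f n ((norm (x - y))\<^sup>2) - ?F x y = 2 * Re (?ph x y * (iexp \<theta> - ?T))"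
      unfolding F right_diff_distrib by (simp only: minus_complex.sel right_diff_distrib)
    also have "\<bar>\<dots>\<bar> \<le> 2 * norm (?ph x y * (iexp \<theta> - ?T))"
      using abs_Re_le_cmod[of "?ph x y * (iexp \<theta> - ?T)"] by linarith
    also have "\<dots> = 2 * norm ?c * norm (iexp \<theta> - ?T)"
      by (simp only: norm_mult norm_cis mult_1_right mult.assoc)
    also have "\<dots> \<le> 2 * norm ?c * (\<bar>\<theta>\<bar> ^ Suc m / fact (Suc m))"
      \<comment> \<open>On the imaginary axis the Taylor remainder of \<open>exp\<close> is at most
        the modulus of the first omitted term.\<close>
      by (intro mult_left_mono iexp_approx1) simp
    also have "\<dots> \<le> 2 * norm ?c * ((4 * pi * real n / P * (r * s)) ^ Suc m / fact (Suc m))"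
    proof -
      have "\<bar>(x - x\<^sub>0) \<bullet> (y - y\<^sub>0)\<bar> \<le> norm (x - x\<^sub>0) * norm (y - y\<^sub>0)" by (rule Cauchy_Schwarz_ineq2)
      also have "\<dots> \<le> r * s"
        by (intro mult_mono xy order_trans[OF norm_ge_zero xy(1)] norm_ge_zero)
      finally have "2 * \<omega> * \<bar>(x - x\<^sub>0) \<bullet> (y - y\<^sub>0)\<bar> \<le> 2 * \<omega> * (r * s)"
        using P by (intro mult_left_mono) (auto simp: \<omega>_def)
      moreover have "\<omega> \<ge> 0" using P by (simp add: \<omega>_def)
      ultimately have "\<bar>\<theta>\<bar> \<le> 2 * \<omega> * (r * s)" by (simp add: \<theta>_def abs_mult)
      also have "2 * \<omega> = 4 * pi * real n / P" by (simp add: \<omega>_def)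
      finally show ?thesis
        by (intro mult_left_mono divide_right_mono power_mono) auto
    qed
    finally show ?thesis .
  qed
  ultimately show ?thesis by (rule that)
qed

theorem theorem2p6:
  fixes D Dx Dy Vq :: real
    and q Mf Mt :: nat
    and \<Omega>x \<Omega>y :: "(real ^ 'd) set"
    and K :: "real ^ 'd \<Rightarrow> real ^ 'd \<Rightarrow> real"
    and f fp T :: "real \<Rightarrow> real"
  assumes "q \<ge> 1" and "D > 0"
    and "\<Omega>x \<subseteq> {x. \<forall>i. x $ i \<in> {0 .. D / sqrt (real CARD('d))}}"
    and "\<Omega>y \<subseteq> {y. \<forall>i. y $ i \<in> {0 .. D / sqrt (real CARD('d))}}"
    and "Dx < D" and "\<forall>x\<in>\<Omega>x. \<forall>x'\<in>\<Omega>x. norm (x - x') \<le> Dx"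
    and "Dy < D" and "\<forall>y\<in>\<Omega>y. \<forall>y'\<in>\<Omega>y. norm (y - y') \<le> Dy"
    and "\<forall>x\<in>\<Omega>x. \<forall>y\<in>\<Omega>y. K x y = f ((norm (x - y))\<^sup>2)"
    and "window D T"
    and "fp = periodic_extension D T f"
    and "\<forall>k<q - 1. \<forall>x. (deriv ^^ k) fp differentiable (at x)"
    and "\<forall>k<q. continuous_on UNIV ((deriv ^^ k) fp)"
    and "qth_derivative_variation_le q (4 * D\<^sup>2) fp Vq"
    and "Mf > 0" and "Mt > 0" and "9 * Mf \<le> Mt"
  shows "\<exists>(R::nat) (g :: nat \<Rightarrow> real ^ 'd \<Rightarrow> real) (h :: nat \<Rightarrow> real ^ 'd \<Rightarrow> real).
           R \<le> 4 * Mf * ((Mt + CARD('d)) choose CARD('d)) \<and>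
           (\<forall>x\<in>\<Omega>x. \<forall>y\<in>\<Omega>y.
              \<bar>K x y - (\<Sum>i=1..R. g i x * h i y)\<bar>
                \<le> (SUP z. \<bar>fp z\<bar>) * (Dx * Dy / D\<^sup>2) ^ (Mt + 1)
                  + Vq / (pi * real q) * (2 * D\<^sup>2 / (pi * real Mf)) ^ q)"
proof (cases "\<Omega>x = {} \<or> \<Omega>y = {}")
  case True
  \<comment> \<open>An empty domain offers no centre for the expansion, but the estimate is then
    vacuous.\<close>
  then show ?thesis by (intro exI[of _ 0]) auto
next
  case False
  then obtain x\<^sub>0 y\<^sub>0 where x0: "x\<^sub>0 \<in> \<Omega>x" and y0: "y\<^sub>0 \<in> \<Omega>y" by auto
  define P where "P = 4 * D\<^sup>2"
  have P: "P > 0" using assms(2) by (simp add: P_def)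
  have per: "fp (t + P) = fp t" for t
    unfolding assms(11) P_def by (rule periodic_extension_periodic)
  have cont: "continuous_on UNIV fp" using assms(1,13) by (auto dest: spec[of _ 0])
  define B where "B = (SUP z. \<bar>fp z\<bar>)"
  have B: "\<bar>fp t\<bar> \<le> B" for t
    unfolding B_def by (rule cSUP_upper[OF UNIV_I continuous_periodic_bounded[of P fp, OF P per cont]])
  have B0: "B \<ge> 0" using B[of 0] by linarith
  have r0: "Dx \<ge> 0" "Dy \<ge> 0"
    using assms(6,8) x0 y0 norm_ge_zero order_trans by blast+
  let ?S = "{\<alpha>::'d \<Rightarrow> nat. sum \<alpha> UNIV \<le> Mt}"
  let ?c = "fourier_coeff P fp" and ?s = "\<lambda>x y :: real ^ 'd. (norm (x - y))\<^sup>2"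
  have "\<forall>n. \<exists>F. separable (2 * card ?S) F \<and>
    (\<forall>x y. norm (x - x\<^sub>0) \<le> Dx \<longrightarrow> norm (y - y\<^sub>0) \<le> Dy \<longrightarrow> \<bar>fourier_term P fp n (?s x y) - F x y\<bar>
       \<le> 2 * norm (?c (int n)) * ((4 * pi * real n / P * (Dx * Dy)) ^ Suc Mt / fact (Suc Mt)))"
    using fourier_term_separable[OF P, of Mt x\<^sub>0 Dx y\<^sub>0 Dy fp] by metis
  from choice[OF this] obtain F where sepF: "\<And>n. separable (2 * card ?S) (F n)"
    and F: "\<And>n x y. norm (x - x\<^sub>0) \<le> Dx \<Longrightarrow> norm (y - y\<^sub>0) \<le> Dy \<Longrightarrow>
      \<bar>fourier_term P fp n (?s x y) - F n x y\<bar>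
       \<le> 2 * norm (?c (int n)) * ((4 * pi * real n / P * (Dx * Dy)) ^ Suc Mt / fact (Suc Mt))"
    by blast
  \<comment> \<open>One term for the constant coefficient and \<open>2 * card ?S\<close> for each
    frequency from 1 to \<open>Mf\<close>; the claimed bound is roomy enough to absorb the extra
    1.\<close>
  let ?R = "1 + Mf * (2 * card ?S)"
  let ?G = "\<lambda>x y. Re (?c 0) + (\<Sum>n<Mf. F (Suc n) x y)"
  have "separable ?R ?G"
    by (intro separable_add separable_const separable_sum sepF)
  then obtain g h where gh: "\<And>x y. ?G x y = (\<Sum>i=1..?R. g i x * h i y)"
    unfolding separable_def by blast
  have R: "?R \<le> 4 * Mf * ((Mt + CARD('d)) choose CARD('d))"
  proof -
    let ?b = "(Mt + CARD('d)) choose CARD('d)"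
    have "?b \<ge> 1" by (simp add: Suc_le_eq)
    with \<open>Mf > 0\<close> have "1 * 1 \<le> Mf * ?b" by (intro mult_le_mono) auto
    moreover have "Mf * (2 * card ?S) \<le> Mf * (2 * ?b)"
      by (intro mult_le_mono card_multi_indices_le) auto
    moreover have "4 * Mf * ?b = 4 * (Mf * ?b)" "Mf * (2 * ?b) = 2 * (Mf * ?b)" by simp_all
    ultimately show ?thesis by linarith
  qed
  have "\<bar>K x y - ?G x y\<bar> \<le> B * (Dx * Dy / D\<^sup>2) ^ (Mt + 1)
      + Vq / (pi * real q) * (2 * D\<^sup>2 / (pi * real Mf)) ^ q" if x: "x \<in> \<Omega>x" and y: "y \<in> \<Omega>y" for x y
  proof -
    let ?\<rho> = "Dx * Dy / D\<^sup>2"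
    have \<rho>: "?\<rho> \<ge> 0" using r0 by simp
    have box: "\<forall>i. x $ i \<in> {0..D / sqrt (real CARD('d))}" "\<forall>i. y $ i \<in> {0..D / sqrt (real CARD('d))}"
      using assms(3,4) x y by blast+
    have "\<bar>?s x y\<bar> \<le> D\<^sup>2" using norm_diff_box_le[OF box] by simp
    then have K: "K x y = fp (?s x y)"
      using periodic_extension_eq[OF assms(10)] assms(9) x y by (simp add: assms(11))
    have "\<bar>fp (?s x y) - (Re (?c 0) + (\<Sum>n<Mf. fourier_term P fp (Suc n) (?s x y)))\<bar>
        \<le> Vq / (pi * real q) * (P / (2 * pi * real Mf)) ^ q"
      by (rule fourier_truncation_error[of P fp, OF P per assms(1)])
         (use assms(12-15) in \<open>auto simp: P_def\<close>)
    also have "P / (2 * pi * real Mf) = 2 * D\<^sup>2 / (pi * real Mf)" by (simp add: P_def)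
    finally have 1: "\<bar>K x y - (Re (?c 0) + (\<Sum>n<Mf. fourier_term P fp (Suc n) (?s x y)))\<bar>
        \<le> Vq / (pi * real q) * (2 * D\<^sup>2 / (pi * real Mf)) ^ q" unfolding K .
    let ?E = "(pi * real Mf) ^ Suc Mt / fact (Suc Mt)"
    have "\<bar>fourier_term P fp (Suc n) (?s x y) - F (Suc n) x y\<bar> \<le> 2 * B * (?E * ?\<rho> ^ Suc Mt)"
      if n: "n < Mf" for n
    proof -
      \<comment> \<open>\<open>P = 4 * D^2\<close> cancels the 4 and produces the ratio
        \<open>?\<rho>\<close>; all frequencies are then compared with the largest one,
        \<open>Mf\<close>.\<close>
      have "4 * pi * real (Suc n) / P * (Dx * Dy) = pi * real (Suc n) * ?\<rho>"
        by (simp add: P_def)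
      also have "\<dots> \<le> pi * real Mf * ?\<rho>"
        using n \<rho> by (intro mult_right_mono mult_left_mono) auto
      finally have le: "4 * pi * real (Suc n) / P * (Dx * Dy) \<le> pi * real Mf * ?\<rho>" .
      have nonneg: "4 * pi * real (Suc n) / P * (Dx * Dy) \<ge> 0" using P r0 by simp
      have "(4 * pi * real (Suc n) / P * (Dx * Dy)) ^ Suc Mt / fact (Suc Mt)
          \<le> (pi * real Mf * ?\<rho>) ^ Suc Mt / fact (Suc Mt)"
        by (rule divide_right_mono[OF power_mono[OF le nonneg]]) simp
      also have "\<dots> = ?E * ?\<rho> ^ Suc Mt" by (simp only: power_mult_distrib times_divide_eq_left)
      finally have "2 * norm (?c (int (Suc n))) * ((4 * pi * real (Suc n) / P * (Dx * Dy)) ^ Suc Mt / fact (Suc Mt))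
          \<le> 2 * B * (?E * ?\<rho> ^ Suc Mt)"
        using norm_fourier_coeff_le[OF P cont B, of "int (Suc n)"] B0 P r0
        by (intro mult_mono mult_left_mono) auto
      moreover have "norm (x - x\<^sub>0) \<le> Dx" "norm (y - y\<^sub>0) \<le> Dy"
        using assms(6,8) x y x0 y0 by blast+
      ultimately show ?thesis using F[of x y "Suc n"] by linarith
    qed
    then have "(\<Sum>n<Mf. \<bar>fourier_term P fp (Suc n) (?s x y) - F (Suc n) x y\<bar>)
        \<le> (\<Sum>n<Mf. 2 * B * (?E * ?\<rho> ^ Suc Mt))"
      by (intro sum_mono) auto
    also have "\<dots> = B * ?\<rho> ^ Suc Mt * (2 * real Mf * ?E)"
      by (simp only: sum_constant card_lessThan mult_ac)
    \<comment> \<open>The factor 2 stems from pairing frequencies and \<open>Mf\<close> from their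
      number; \<open>9 * Mf \<le> Mt\<close> makes the product with \<open>?E\<close> at most
      1.\<close>
    also have "\<dots> \<le> B * ?\<rho> ^ Suc Mt * 1"
      using B0 \<rho> assms(15,17)
      by (intro mult_left_mono taylor_remainder_constant_le mult_nonneg_nonneg zero_le_power) simp_all
    finally have "(\<Sum>n<Mf. \<bar>fourier_term P fp (Suc n) (?s x y) - F (Suc n) x y\<bar>)
        \<le> B * ?\<rho> ^ (Mt + 1)" by simp
    then have 2: "\<bar>\<Sum>n<Mf. (fourier_term P fp (Suc n) (?s x y) - F (Suc n) x y)\<bar> \<le> B * ?\<rho> ^ (Mt + 1)"
      by (rule order_trans[OF sum_abs])
    show ?thesis using 1 2 unfolding sum_subtractf by linarith
  qed
  with R show ?thesis unfolding gh B_def by blast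
qed

end
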